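(* Let $m,n\geq2$ be integers. All meromorphic solutions $u(z_1,z_2)$ in $\mathbf{C}^2$ to the equation $$u_{z_1}^m+u_{z_2}^n=1$$ must be affine.
   Context: Subscripts $z_1,z_2$ denote partial derivatives. Affine means of the form $u(z_1,z_2)=az_1+bz_2+c$ with constants $a,b,c\in\mathbf{C}$. *)

theory Defs
  imports "HOL-Complex_Analysis.Complex_Analysis"
begin

(* Complex Frechet differentiability at every point of U; intended for open U. *)
definition holomorphic2_on :: "(complex \<times> complex \<Rightarrow> complex) \<Rightarrow> (complex \<times> complex) set \<Rightarrow> bool" where
  "holomorphic2_on f U \<longleftrightarrow>
     (\<forall>p\<in>U. \<exists>a b. (f has_derivative (\<lambda>(s, t). a * s + b * t)) (at p))"

(* As for meromorphic_on in one variable, a meromorphic function is represented by a total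
   function, whose values on the zero sets of the local denominators (poles, points of
   indeterminacy, removable singularities) are unconstrained. Connectedness of U together
   with a point where h does not vanish says that h is a nonzero element of the integral
   domain of holomorphic functions on U. *)
definition meromorphic2_on :: "(complex \<times> complex \<Rightarrow> complex) \<Rightarrow> (complex \<times> complex) set \<Rightarrow> bool" where
  "meromorphic2_on u D \<longleftrightarrow>
     (\<forall>p\<in>D. \<exists>U g h. open U \<and> connected U \<and> p \<in> U \<and>
        holomorphic2_on g U \<and> holomorphic2_on h U \<and> (\<exists>z\<in>U. h z \<noteq> 0) \<and>
        (\<forall>z\<in>U. h z \<noteq> 0 \<longrightarrow> u z = g z / h z))"

(* For u meromorphic on all of C^2 this set is open and dense, since it contains the points
   where a local denominator does not vanish. Identities between meromorphic functions are
   stated on it: the values of u elsewhere carry no information. *)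
definition regular_points :: "(complex \<times> complex \<Rightarrow> complex) \<Rightarrow> (complex \<times> complex) set" where
  "regular_points u = {p. \<exists>U. open U \<and> p \<in> U \<and> holomorphic2_on u U}"

definition partial1 :: "(complex \<times> complex \<Rightarrow> complex) \<Rightarrow> complex \<times> complex \<Rightarrow> complex" where
  "partial1 u z = deriv (\<lambda>w. u (w, snd z)) (fst z)"

definition partial2 :: "(complex \<times> complex \<Rightarrow> complex) \<Rightarrow> complex \<times> complex \<Rightarrow> complex" where
  "partial2 u z = deriv (\<lambda>w. u (fst z, w)) (snd z)"

end

theory Submission
  imports Defs
begin

text \<open>
  Along a solution the gradient \<open>(p, q)\<close> is constant on characteristic lines, whose direction
  \<open>(m p\<^sup>m\<^sup>-\<^sup>1, n q\<^sup>n\<^sup>-\<^sup>1)\<close> is determined by \<open>(p, q)\<close>. As \<open>u\<close> is meromorphic, its singularities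
  on such a line are isolated, so the gradient keeps its value on the whole line. Two non-parallel
  characteristics can therefore only meet in a singular point. For a fixed characteristic these
  intersections form a connected countable set, that is, a single point. Hence near some point the
  characteristics are either all parallel, in which case \<open>p\<close> satisfies a fixed polynomial equation and
  \<open>u\<close> is affine, or they all pass through one point \<open>w\<close>. In the latter case restrict to a line
  parallel to the second axis, with coordinate \<open>t\<close>, that avoids \<open>w\<close>: the gradient satisfies
  \<open>p\<^sup>m + q\<^sup>n = 1\<close> and \<open>c n q\<^sup>n\<^sup>-\<^sup>1 = (t - w\<^sub>2) m p\<^sup>m\<^sup>-\<^sup>1\<close>. So \<open>p\<close> has no zeros, \<open>1/p\<close> grows at
  most linearly and is therefore a polynomial of degree at most one, but it can take
  \<open>m\<close>-th roots of unity as values only at \<open>t = w\<^sub>2\<close>, which is impossible.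
\<close>

section \<open>Holomorphic functions of two variables\<close>

lemma has_derivative2_line:
  assumes "(f has_derivative (\<lambda>(s, t). a * s + b * t)) (at (z1 + c * v1, z2 + c * v2))"
  shows "((\<lambda>c. f (z1 + c * v1, z2 + c * v2)) has_field_derivative a * v1 + b * v2) (at c)"
proof -
  have *: "((\<lambda>c. (z1 + c * v1, z2 + c * v2)) has_derivative (\<lambda>h. (h * v1, h * v2))) (at c)"
    by (auto intro!: derivative_eq_intros)
  have "((\<lambda>c. f (z1 + c * v1, z2 + c * v2)) has_derivative
          (\<lambda>h. (\<lambda>(s, t). a * s + b * t) (h * v1, h * v2))) (at c)"
    using diff_chain_at[OF * assms] by (simp add: o_def)
  then show ?thesis
    unfolding has_field_derivative_def by (rule has_derivative_eq_rhs) (auto simp: algebra_simps)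
qed

lemma holomorphic2_on_partials:
  assumes "holomorphic2_on f U" "z \<in> U"
  shows "(f has_derivative (\<lambda>(s, t). partial1 f z * s + partial2 f z * t)) (at z)"
proof -
  obtain a b where ab: "(f has_derivative (\<lambda>(s, t). a * s + b * t)) (at z)"
    using assms unfolding holomorphic2_on_def by blast
  have "((\<lambda>w. f (w, snd z)) has_field_derivative a) (at (fst z))"
    using has_derivative2_line[of f a b 0 "fst z" 1 "snd z" 0] ab by simp
  moreover have "((\<lambda>w. f (fst z, w)) has_field_derivative b) (at (snd z))"
    using has_derivative2_line[of f a b "fst z" "snd z" 0 0 1] ab by simp
  ultimately show ?thesis
    using ab by (simp add: partial1_def partial2_def DERIV_imp_deriv)
qed

lemma holomorphic2_on_line:
  assumes "holomorphic2_on f U" "(z1 + c * v1, z2 + c * v2) \<in> U"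
  shows "((\<lambda>c. f (z1 + c * v1, z2 + c * v2)) has_field_derivative
    partial1 f (z1 + c * v1, z2 + c * v2) * v1 + partial2 f (z1 + c * v1, z2 + c * v2) * v2) (at c)"
  by (rule has_derivative2_line) (rule holomorphic2_on_partials[OF assms])

lemma holomorphic2_on_imp_holomorphic_on_line:
  assumes "holomorphic2_on f U" "\<And>c. c \<in> S \<Longrightarrow> (z1 + c * v1, z2 + c * v2) \<in> U"
  shows "(\<lambda>c. f (z1 + c * v1, z2 + c * v2)) holomorphic_on S"
  using holomorphic2_on_line[OF assms(1)] assms(2)
  by (meson field_differentiable_at_within field_differentiable_def holomorphic_onI)

lemma holomorphic2_on_slice1:
  assumes "holomorphic2_on f U" "(x, y) \<in> U"
  shows "((\<lambda>w. f (w, y)) has_field_derivative partial1 f (x, y)) (at x)"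
  using holomorphic2_on_line[OF assms(1), of 0 x 1 y 0] assms(2) by simp

lemma holomorphic2_on_slice2:
  assumes "holomorphic2_on f U" "(x, y) \<in> U"
  shows "((\<lambda>w. f (x, w)) has_field_derivative partial2 f (x, y)) (at y)"
  using holomorphic2_on_line[OF assms(1), of x y 0 0 1] assms(2) by simp

lemma holomorphic2_on_imp_holomorphic_on_slice1:
  assumes "holomorphic2_on f U" "\<And>w. w \<in> S \<Longrightarrow> (w, y) \<in> U"
  shows "(\<lambda>w. f (w, y)) holomorphic_on S"
  using holomorphic2_on_imp_holomorphic_on_line[OF assms(1), of S 0 1 y 0] assms(2) by simp

lemma holomorphic2_on_imp_holomorphic_on_slice2:
  assumes "holomorphic2_on f U" "\<And>w. w \<in> S \<Longrightarrow> (x, w) \<in> U"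
  shows "(\<lambda>w. f (x, w)) holomorphic_on S"
  using holomorphic2_on_imp_holomorphic_on_line[OF assms(1), of S x 0 0 1] assms(2) by simp

lemma holomorphic2_on_imp_continuous_on: "holomorphic2_on f U \<Longrightarrow> continuous_on U f"
  unfolding holomorphic2_on_def
  by (meson continuous_at_imp_continuous_on has_derivative_continuous)

lemma holomorphic2_on_subset: "holomorphic2_on f U \<Longrightarrow> V \<subseteq> U \<Longrightarrow> holomorphic2_on f V"
  unfolding holomorphic2_on_def by blast

lemma has_derivative2_cong:
  assumes "(f has_derivative D) (at z)" "open U" "z \<in> U" "\<And>w. w \<in> U \<Longrightarrow> f w = g w"
  shows "(g has_derivative D) (at z)"
  using has_derivative_transform_within_open[OF assms(1-3)] assms(4) by blast

lemma holomorphic2_on_cong: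
  assumes "holomorphic2_on f U" "open U" "\<And>z. z \<in> U \<Longrightarrow> f z = g z"
  shows "holomorphic2_on g U"
  using assms has_derivative2_cong unfolding holomorphic2_on_def by metis

lemma partials_cong:
  assumes "holomorphic2_on f U" "open U" "\<And>z. z \<in> U \<Longrightarrow> f z = g z" "z \<in> U"
  shows "partial1 g z = partial1 f z" "partial2 g z = partial2 f z"
proof -
  have "(g has_derivative (\<lambda>(s, t). partial1 f z * s + partial2 f z * t)) (at z)"
    using has_derivative2_cong[OF holomorphic2_on_partials[OF assms(1,4)] assms(2,4)] assms(3) by blast
  moreover have "(g has_derivative (\<lambda>(s, t). partial1 g z * s + partial2 g z * t)) (at z)"
    by (intro holomorphic2_on_partials[OF _ assms(4)] holomorphic2_on_cong[OF assms(1-3)])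
  ultimately have eq: "(\<lambda>(s, t). partial1 g z * s + partial2 g z * t) = (\<lambda>(s, t). partial1 f z * s + partial2 f z * t)"
    by (rule has_derivative_unique[rotated])
  show "partial1 g z = partial1 f z" using fun_cong[OF eq, of "(1, 0)"] by simp
  show "partial2 g z = partial2 f z" using fun_cong[OF eq, of "(0, 1)"] by simp
qed

lemma holomorphic2_on_diff:
  assumes "holomorphic2_on f U" "holomorphic2_on g U"
  shows "holomorphic2_on (\<lambda>z. f z - g z) U"
  unfolding holomorphic2_on_def
proof (intro ballI exI)
  fix z assume "z \<in> U"
  note f = holomorphic2_on_partials[OF assms(1) this] and g = holomorphic2_on_partials[OF assms(2) this]
  show "((\<lambda>z. f z - g z) has_derivative (\<lambda>(s, t). (partial1 f z - partial1 g z) * s + (partial2 f z - partial2 g z) * t)) (at z)"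
    by (rule has_derivative_eq_rhs[OF has_derivative_diff[OF f g]]) (auto simp: algebra_simps)
qed

lemma holomorphic2_on_mult:
  assumes "holomorphic2_on f U" "holomorphic2_on g U"
  shows "holomorphic2_on (\<lambda>z. f z * g z) U"
  unfolding holomorphic2_on_def
proof (intro ballI exI)
  fix z assume "z \<in> U"
  note f = holomorphic2_on_partials[OF assms(1) this] and g = holomorphic2_on_partials[OF assms(2) this]
  show "((\<lambda>z. f z * g z) has_derivative (\<lambda>(s, t). (f z * partial1 g z + g z * partial1 f z) * s
      + (f z * partial2 g z + g z * partial2 f z) * t)) (at z)"
    by (rule has_derivative_eq_rhs[OF has_derivative_mult[OF f g]]) (auto simp: algebra_simps)
qed

lemma holomorphic2_on_inverse:
  assumes "holomorphic2_on f U" "\<And>z. z \<in> U \<Longrightarrow> f z \<noteq> 0"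
  shows "holomorphic2_on (\<lambda>z. inverse (f z)) U"
  unfolding holomorphic2_on_def
proof (intro ballI exI)
  fix z assume "z \<in> U"
  note f = holomorphic2_on_partials[OF assms(1) this]
  show "((\<lambda>z. inverse (f z)) has_derivative (\<lambda>(s, t). (- partial1 f z / (f z)\<^sup>2) * s
      + (- partial2 f z / (f z)\<^sup>2) * t)) (at z)"
    by (rule has_derivative_eq_rhs[OF Deriv.has_derivative_inverse[OF assms(2)[OF \<open>z \<in> U\<close>] f]])
       (auto simp: fun_eq_iff field_simps power2_eq_square add_divide_distrib)
qed

lemma holomorphic2_on_divide:
  assumes "holomorphic2_on f U" "holomorphic2_on g U" "\<And>z. z \<in> U \<Longrightarrow> g z \<noteq> 0"
  shows "holomorphic2_on (\<lambda>z. f z / g z) U"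
  using holomorphic2_on_mult[OF assms(1) holomorphic2_on_inverse[OF assms(2,3)]]
  by (simp add: divide_inverse)

lemma holomorphic2_on_affine: "holomorphic2_on (\<lambda>z. a * fst z + b * snd z + c) U"
  unfolding holomorphic2_on_def
proof (intro ballI exI)
  fix z
  show "((\<lambda>z. a * fst z + b * snd z + c) has_derivative (\<lambda>(s, t). a * s + b * t)) (at z)"
    by (auto intro!: derivative_eq_intros)
qed

text \<open>Serves both the exchange of the two coordinates and the linear change of coordinates
  that moves an arbitrary complex line onto \<open>fst z = 0\<close>.\<close>

lemma holomorphic2_on_compose_affine:
  assumes "holomorphic2_on f U" and "\<And>z. z \<in> V \<Longrightarrow> (a * fst z + b * snd z + c, a' * fst z + b' * snd z + c') \<in> U"
  shows "holomorphic2_on (\<lambda>z. f (a * fst z + b * snd z + c, a' * fst z + b' * snd z + c')) V"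
  unfolding holomorphic2_on_def
proof (intro ballI exI)
  fix z assume "z \<in> V"
  let ?T = "\<lambda>z. (a * fst z + b * snd z + c, a' * fst z + b' * snd z + c')"
  note f = holomorphic2_on_partials[OF assms(1) assms(2)[OF \<open>z \<in> V\<close>]]
  have T: "(?T has_derivative (\<lambda>(s, t). (a * s + b * t, a' * s + b' * t))) (at z)"
    by (auto intro!: derivative_eq_intros)
  have "((\<lambda>z. f (?T z)) has_derivative (\<lambda>w. (\<lambda>(s, t). partial1 f (?T z) * s + partial2 f (?T z) * t)
      ((\<lambda>(s, t). (a * s + b * t, a' * s + b' * t)) w))) (at z)"
    using diff_chain_at[OF T f] by (simp add: o_def)
  then show "((\<lambda>z. f (?T z)) has_derivative (\<lambda>(s, t). (a * partial1 f (?T z) + a' * partial2 f (?T z)) * s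
      + (b * partial1 f (?T z) + b' * partial2 f (?T z)) * t)) (at z)"
    by (rule has_derivative_eq_rhs) (auto simp: algebra_simps)
qed

section \<open>Identity theorem in two variables\<close>

text \<open>On the complex line through a point of \<open>V\<close> and \<open>w\<close> this is the
  identity theorem in one variable. Convexity of \<open>U\<close> makes the set of parameters
  landing in \<open>U\<close> convex, hence connected.\<close>

lemma holomorphic2_eq_0_convex:
  assumes hol: "holomorphic2_on f U" and U: "open U" "convex U"
    and V: "open V" "V \<subseteq> U" "V \<noteq> {}" and 0: "\<And>z. z \<in> V \<Longrightarrow> f z = 0" and w: "w \<in> U"
  shows "f w = 0"
proof -
  obtain z where z: "z \<in> V" using V by blast
  define L where "L c = (fst z + c * (fst w - fst z), snd z + c * (snd w - snd z))" for c :: complex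
  have contL: "continuous_on UNIV L" unfolding L_def by (intro continuous_intros)
  have opn: "open (L -` W)" if "open W" for W
    using continuous_open_vimage[OF that] contL continuous_on_eq_continuous_at[of UNIV L] by auto
  have "convex (L -` U)"
  proof (rule convexI)
    fix x y and u v :: real assume *: "x \<in> L -` U" "y \<in> L -` U" "0 \<le> u" "0 \<le> v" "u + v = 1"
    have "L (u *\<^sub>R x + v *\<^sub>R y) = u *\<^sub>R L x + v *\<^sub>R L y"
    proof -
      have u: "complex_of_real u = 1 - of_real v" using *(5) by (metis add_diff_cancel_right' of_real_1 of_real_diff)
      show ?thesis unfolding L_def scaleR_conv_of_real u scaleR_prod_def by (simp add: algebra_simps)
    qed
    then show "u *\<^sub>R x + v *\<^sub>R y \<in> L -` U"
      using * \<open>convex U\<close> by (simp add: convexD)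
  qed
  then have con: "connected (L -` U)" by (rule convex_connected)
  have L0: "L 0 = z" and L1: "L 1 = w" by (simp_all add: L_def)
  have "f (L 1) = 0"
  proof (rule analytic_continuation_open[of "L -` V" "L -` U" "\<lambda>c. f (L c)" "\<lambda>_. 0"])
    show "L -` V \<noteq> {}" using L0 z by blast
    show "(\<lambda>c. f (L c)) holomorphic_on L -` U"
      unfolding L_def by (rule holomorphic2_on_imp_holomorphic_on_line[OF hol]) simp
  qed (use opn V U con 0 L1 w in auto)
  then show ?thesis by (simp add: L1)
qed

text \<open>The interior of the zero set is closed in \<open>U\<close>: a ball around a limit point
  meets it in an open set, and the convex case applies to that ball.\<close>

lemma holomorphic2_eq_0:
  assumes hol: "holomorphic2_on f U" and U: "open U" "connected U"
    and V: "open V" "V \<subseteq> U" "V \<noteq> {}" and 0: "\<And>z. z \<in> V \<Longrightarrow> f z = 0" and w: "w \<in> U"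
  shows "f w = 0"
proof -
  define Z where "Z = {z. \<exists>V. open V \<and> z \<in> V \<and> V \<subseteq> U \<and> (\<forall>z\<in>V. f z = 0)}"
  have "open Z" unfolding Z_def by (subst open_subopen) blast
  have ZU: "Z \<subseteq> U" unfolding Z_def by blast
  have "closedin (top_of_set U) Z"
    unfolding closedin_limpt
  proof (intro conjI allI impI)
    fix x assume x: "x islimpt Z \<and> x \<in> U"
    obtain e where e: "e > 0" "ball x e \<subseteq> U" using U x openE by blast
    then obtain y where y: "y \<in> Z" "y \<in> ball x e"
      using x unfolding islimpt_def by (meson open_ball centre_in_ball)
    then obtain V where V: "open V" "y \<in> V" "V \<subseteq> U" "\<forall>z\<in>V. f z = 0" unfolding Z_def by blast
    have "f z = 0" if "z \<in> ball x e" for z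
    proof (rule holomorphic2_eq_0_convex[of f "ball x e" "V \<inter> ball x e"])
      show "holomorphic2_on f (ball x e)" using hol e holomorphic2_on_subset by blast
    qed (use V y that in auto)
    then show "x \<in> Z" unfolding Z_def using e by (auto intro!: exI[of _ "ball x e"])
  qed (use ZU in auto)
  moreover have "openin (top_of_set U) Z"
    using \<open>open Z\<close> ZU by (simp add: open_subset)
  moreover have "Z \<noteq> {}" using V 0 unfolding Z_def by blast
  ultimately have "Z = U" using U(2) unfolding connected_clopen by blast
  then show ?thesis using w unfolding Z_def by blast
qed

section \<open>Regular points and their density\<close>

lemma open_regular_points: "open (regular_points u)"
  unfolding regular_points_def by (subst open_subopen) blast

lemma holomorphic2_on_regular_points: "holomorphic2_on u (regular_points u)"
  unfolding regular_points_def holomorphic2_on_def by blast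

lemma regular_pointsI: "open U \<Longrightarrow> holomorphic2_on u U \<Longrightarrow> U \<subseteq> regular_points u"
  unfolding regular_points_def by blast

lemma open_nonzero:
  assumes "continuous_on U (f :: 'a::topological_space \<Rightarrow> complex)" "open U"
  shows "open {z \<in> U. f z \<noteq> 0}"
proof -
  have "{z \<in> U. f z \<noteq> 0} = U \<inter> f -` (- {0})" by auto
  then show ?thesis using continuous_open_preimage[OF assms, of "- {0}"] by (metis open_Compl closed_singleton)
qed

text \<open>If the functions differ somewhere, they differ on a nonempty open set, which meets
  \<open>R\<close>. Used to carry identities from a dense set, such as the regular points, to all of
  \<open>U\<close>.\<close>

lemma eq_on_dense:
  fixes f g :: "'a::topological_space \<Rightarrow> complex"
  assumes "continuous_on U f" "continuous_on U g" "open U"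
    and dense: "\<And>V. open V \<Longrightarrow> V \<noteq> {} \<Longrightarrow> V \<inter> R \<noteq> {}"
    and eq: "\<And>z. z \<in> U \<inter> R \<Longrightarrow> f z = g z" and "z \<in> U"
  shows "f z = g z"
proof (rule ccontr)
  assume "f z \<noteq> g z"
  have "open {z \<in> U. f z - g z \<noteq> 0}"
    by (intro open_nonzero continuous_intros assms)
  then obtain w where "w \<in> U" "f w \<noteq> g w" "w \<in> R"
    using dense[of "{z \<in> U. f z - g z \<noteq> 0}"] \<open>f z \<noteq> g z\<close> \<open>z \<in> U\<close> by auto
  then show False using eq by blast
qed

text \<open>By the identity theorem a local denominator cannot vanish on a nonempty open part of its
  domain, and where it is nonzero \<open>u\<close> is a quotient of holomorphic functions.\<close>

lemma dense_regular_points: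
  assumes "meromorphic2_on u UNIV" "open V" "V \<noteq> {}"
  shows "V \<inter> regular_points u \<noteq> {}"
proof -
  obtain p where "p \<in> V" using assms by blast
  obtain U g h where U: "open U" "connected U" "p \<in> U"
      and g: "holomorphic2_on g U" and h: "holomorphic2_on h U" and hz: "\<exists>z\<in>U. h z \<noteq> 0"
      and u: "\<forall>z\<in>U. h z \<noteq> 0 \<longrightarrow> u z = g z / h z"
    using assms(1)[unfolded meromorphic2_on_def, rule_format, of p] by auto
  obtain w where w: "w \<in> U \<inter> V" "h w \<noteq> 0"
    using holomorphic2_eq_0[OF h U(1,2), of "U \<inter> V"] hz U \<open>p \<in> V\<close> \<open>open V\<close> by blast
  let ?W = "{z \<in> U. h z \<noteq> 0}"
  have W: "open ?W" by (intro open_nonzero holomorphic2_on_imp_continuous_on[OF h] U)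
  have "holomorphic2_on (\<lambda>z. g z / h z) ?W"
    by (intro holomorphic2_on_divide holomorphic2_on_subset[OF g] holomorphic2_on_subset[OF h]) auto
  then have "holomorphic2_on u ?W"
    by (rule holomorphic2_on_cong) (use W u in auto)
  then show ?thesis using regular_pointsI[OF W] w by blast
qed

section \<open>Osgood's lemma and holomorphy of the partial derivatives\<close>

lemma open_contains_bicball:
  assumes "open U" "(x, y) \<in> (U :: (complex \<times> complex) set)"
  obtains r where "r > 0" "cball x r \<times> cball y r \<subseteq> U"
proof -
  obtain A B where AB: "open A" "x \<in> A" "open B" "y \<in> B" "A \<times> B \<subseteq> U"
    using open_prod_elim[OF assms] by (metis mem_Sigma_iff)
  obtain r1 r2 where "r1 > 0" "cball x r1 \<subseteq> A" "r2 > 0" "cball y r2 \<subseteq> B"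
    using AB open_contains_cball by meson
  then have "min r1 r2 > 0" "cball x (min r1 r2) \<times> cball y (min r1 r2) \<subseteq> U"
    using AB(5) by (auto simp: subset_iff)
  then show ?thesis using that by blast
qed

text \<open>Cauchy's inequality, applied to the difference of two slices shifted to the common
  centre 0, bounds the difference of the partial derivatives by a supremum that uniform continuity
  makes small.\<close>

lemma continuous_on_partial1:
  assumes cont: "continuous_on U f" and U: "open U"
    and der: "\<And>x y. (x, y) \<in> U \<Longrightarrow> (\<lambda>w. f (w, y)) field_differentiable at x"
  shows "continuous_on U (partial1 f)"
proof (rule continuous_at_imp_continuous_on, rule ballI)
  fix p assume "p \<in> U"
  obtain x0 y0 where p: "p = (x0, y0)" by (cases p)
  obtain r where r: "r > 0" "cball x0 r \<times> cball y0 r \<subseteq> U"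
    using open_contains_bicball[OF U] \<open>p \<in> U\<close> p by metis
  have uc: "uniformly_continuous_on (cball x0 r \<times> cball y0 r) f"
    by (intro compact_uniformly_continuous continuous_on_subset[OF cont r(2)] compact_Times compact_cball)
  show "isCont (partial1 f) p"
    unfolding continuous_at_eps_delta
  proof (intro allI impI)
    fix e :: real assume "e > 0"
    \<comment> \<open>A disc of radius \<open>s\<close> around any \<open>x\<close> within
      \<open>s\<close> of \<open>x0\<close> stays in \<open>cball x0 r\<close>. Cauchy's inequality
      divides by \<open>s\<close>, hence the tolerance \<open>e / 2 * s\<close>.\<close>
    define s where "s = r / 3"
    have s: "s > 0" using r by (simp add: s_def)
    then have "e / 2 * s > 0" using \<open>e > 0\<close> by simp
    then obtain d where d: "d > 0" "\<And>z z'. z \<in> cball x0 r \<times> cball y0 r \<Longrightarrow> z' \<in> cball x0 r \<times> cball y0 r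
        \<Longrightarrow> dist z' z < d \<Longrightarrow> dist (f z') (f z) < e / 2 * s"
      using uc unfolding uniformly_continuous_on_def by metis
    have "dist (partial1 f q) (partial1 f p) < e" if q: "dist q p < min d s" for q
    proof -
      obtain x y where xy: "q = (x, y)" by (cases q)
      have dx: "dist x x0 < s" and dy: "dist y y0 < s"
        using q dist_fst_le[of q p] dist_snd_le[of q p] by (auto simp: xy p)
      have inU: "(w, y) \<in> cball x0 r \<times> cball y0 r" if "w \<in> cball x s" for w
      proof -
        have "dist w x0 \<le> dist w x + dist x x0" by (rule dist_triangle)
        then show ?thesis using that dx dy s by (auto simp: s_def dist_commute)
      qed
      have inU0: "(w, y0) \<in> cball x0 r \<times> cball y0 r" if "w \<in> cball x0 s" for w
        using that s r by (auto simp: s_def)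
      define g where "g w = f (x + w, y) - f (x0 + w, y0)" for w
      have dg: "(g has_field_derivative deriv (\<lambda>w. f (w, y)) (x + w) - deriv (\<lambda>w. f (w, y0)) (x0 + w)) (at w)"
        if "w \<in> cball 0 s" for w
      proof -
        have "(x + w, y) \<in> U" "(x0 + w, y0) \<in> U"
          using inU[of "x + w"] inU0[of "x0 + w"] that r(2) by (auto simp: dist_norm)
        then have "((\<lambda>w. f (w, y)) has_field_derivative deriv (\<lambda>w. f (w, y)) (x + w)) (at (w + x))"
                  "((\<lambda>w. f (w, y0)) has_field_derivative deriv (\<lambda>w. f (w, y0)) (x0 + w)) (at (w + x0))"
          using der by (simp_all add: DERIV_deriv_iff_field_differentiable add.commute)
        then show ?thesis
          unfolding DERIV_shift g_def by (intro DERIV_diff) (simp_all add: add.commute)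
      qed
      have hol: "g holomorphic_on cball 0 s"
        unfolding holomorphic_on_def using dg field_differentiable_def field_differentiable_at_within by blast
      have "norm ((deriv ^^ 1) g 0) \<le> fact 1 * (e / 2 * s) / s ^ 1"
      proof (rule Cauchy_inequality)
        show "g holomorphic_on ball 0 s" using hol by (rule holomorphic_on_subset) auto
        show "continuous_on (cball 0 s) g" using hol by (rule holomorphic_on_imp_continuous_on)
        show "norm (g w) \<le> e / 2 * s" if "norm (0 - w) = s" for w
        proof -
          have "dist (x + w, y) (x0 + w, y0) = dist q p" by (simp add: xy p dist_Pair_Pair)
          then have "dist (f (x + w, y)) (f (x0 + w, y0)) < e / 2 * s"
            using d(2)[of "(x0 + w, y0)" "(x + w, y)"] inU[of "x + w"] inU0[of "x0 + w"] that q
            by (auto simp: dist_norm)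
          then show ?thesis by (simp add: g_def dist_norm)
        qed
      qed (use s in auto)
      moreover have "deriv g 0 = partial1 f q - partial1 f p"
        using dg[of 0] s by (simp add: DERIV_imp_deriv partial1_def xy p)
      ultimately show ?thesis using s \<open>e > 0\<close> by (simp add: dist_norm)
    qed
    then show "\<exists>d>0. \<forall>q. dist q p < d \<longrightarrow> dist (partial1 f q) (partial1 f p) < e"
      using d(1) s by (intro exI[of _ "min d s"]) auto
  qed
qed

text \<open>All six coefficients are written out so that unfolding gives the shape of
  \<open>holomorphic2_on_compose_affine\<close>.\<close>

lemma swap_affine: "prod.swap z = (0 * fst z + 1 * snd z + 0, 1 * fst z + 0 * snd z + (0::complex))"
  by (cases z) auto

lemma holomorphic2_on_swap:
  assumes "holomorphic2_on f U"
  shows "holomorphic2_on (\<lambda>z. f (prod.swap z)) (prod.swap -` U)"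
  unfolding swap_affine
  by (rule holomorphic2_on_compose_affine[OF assms]) (auto simp: swap_affine[symmetric])

lemma open_swap: "open U \<Longrightarrow> open (prod.swap -` (U :: (complex \<times> complex) set))"
  by (rule continuous_open_vimage) (auto intro!: continuous_intros)

lemma partial_swap: "partial1 (\<lambda>z. f (prod.swap z)) = (\<lambda>z. partial2 f (prod.swap z))"
  "partial2 (\<lambda>z. f (prod.swap z)) = (\<lambda>z. partial1 f (prod.swap z))"
  by (auto simp: partial1_def partial2_def)

lemma continuous_on_partial2:
  assumes cont: "continuous_on U f" and U: "open U"
    and der: "\<And>x y. (x, y) \<in> U \<Longrightarrow> (\<lambda>w. f (x, w)) field_differentiable at y"
  shows "continuous_on U (partial2 f)"
proof -
  have "continuous_on (prod.swap -` U) (partial1 (\<lambda>z. f (prod.swap z)))"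
  proof (rule continuous_on_partial1)
    show "continuous_on (prod.swap -` U) (\<lambda>z. f (prod.swap z))"
      by (rule continuous_on_compose2[OF cont]) (auto intro!: continuous_intros)
    show "open (prod.swap -` U)" by (rule open_swap[OF U])
  qed (use der in auto)
  then have "continuous_on U (\<lambda>z. partial1 (\<lambda>z. f (prod.swap z)) (prod.swap z))"
    by (rule continuous_on_compose2) (auto intro!: continuous_intros)
  then show ?thesis by (simp add: partial_swap)
qed

text \<open>Differentiability in each variable and continuity of one partial derivative give joint
  differentiability; \<open>continuous_on_partial2\<close> supplies that continuity. Later
  holomorphy proofs thereby reduce to continuity and slices.\<close>

lemma osgood:
  assumes cont: "continuous_on U f" and U: "open U"
    and der1: "\<And>x y. (x, y) \<in> U \<Longrightarrow> (\<lambda>w. f (w, y)) field_differentiable at x"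
    and der2: "\<And>x y. (x, y) \<in> U \<Longrightarrow> (\<lambda>w. f (x, w)) field_differentiable at y"
  shows "holomorphic2_on f U"
  unfolding holomorphic2_on_def
proof (intro ballI exI)
  fix p assume "p \<in> U"
  obtain x0 y0 where p: "p = (x0, y0)" by (cases p)
  obtain r where r: "r > 0" "cball x0 r \<times> cball y0 r \<subseteq> U"
    using open_contains_bicball[OF U] \<open>p \<in> U\<close> p by metis
  let ?X = "ball x0 r" and ?Y = "ball y0 r"
  have sub: "?X \<times> ?Y \<subseteq> U" using r(2) by (auto simp: subset_iff)
  have "((\<lambda>(x, y). f (x, y)) has_derivative
     (\<lambda>(tx, ty). partial1 f p * tx + blinfun_mult_right (partial2 f (x0, y0)) ty)) (at (x0, y0) within ?X \<times> ?Y)"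
  proof (rule has_derivative_partialsI)
    have "((\<lambda>w. f (w, y0)) has_field_derivative partial1 f p) (at x0)"
      using der1[of x0 y0] \<open>p \<in> U\<close> by (simp add: p partial1_def DERIV_deriv_iff_field_differentiable)
    then show "((\<lambda>x. f (x, y0)) has_derivative (\<lambda>tx. partial1 f p * tx)) (at x0 within ?X)"
      using has_derivative_at_withinI by (auto simp: has_field_derivative_def)
    show "((\<lambda>y. f (x, y)) has_derivative blinfun_apply (blinfun_mult_right (partial2 f (x, y)))) (at y within ?Y)"
      if "x \<in> ?X" "y \<in> ?Y" for x y
    proof -
      have "((\<lambda>w. f (x, w)) has_field_derivative partial2 f (x, y)) (at y)"
        using der2[of x y] sub that by (auto simp: subset_iff partial2_def DERIV_deriv_iff_field_differentiable)
      then show ?thesis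
        using has_derivative_at_withinI
        by (auto simp: has_field_derivative_def blinfun_mult_right.rep_eq)
    qed
    have "continuous_on (?X \<times> ?Y) (\<lambda>p. blinfun_mult_right (partial2 f p))"
      by (intro bounded_linear.continuous_on[OF bounded_linear_blinfun_mult_right]
                continuous_on_subset[OF continuous_on_partial2[OF cont U der2] sub])
    then show "continuous (at (x0, y0) within ?X \<times> ?Y) (\<lambda>(x, y). blinfun_mult_right (partial2 f (x, y)))"
      using r(1) by (simp add: continuous_on_eq_continuous_within split_def)
  qed (use r in auto)
  then have "(f has_derivative (\<lambda>(tx, ty). partial1 f p * tx + partial2 f p * ty)) (at (x0, y0) within ?X \<times> ?Y)"
    by (simp add: p blinfun_mult_right.rep_eq)
  moreover have "at (x0, y0) within ?X \<times> ?Y = at (x0, y0)"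
    using r(1) by (intro at_within_open) (auto intro!: open_Times)
  ultimately show "(f has_derivative (\<lambda>(s, t). partial1 f p * s + partial2 f p * t)) (at p)"
    by (simp add: p)
qed

text \<open>The difference quotients of \<open>f\<close> in the first variable are holomorphic in
  the second and converge uniformly to \<open>partial1 f\<close>. Weierstrass' theorem then gives
  holomorphy of the limit and also convergence of the derivatives, which is kept in the conclusion
  because it yields the symmetry of mixed partials.\<close>

lemma partial1_slice2:
  assumes hol: "holomorphic2_on f U" and U: "open U" and xy: "(x, y) \<in> U"
  obtains h :: "nat \<Rightarrow> complex" and D where "h \<longlonglongrightarrow> 0" "\<And>k. h k \<noteq> 0"
    "((\<lambda>w. partial1 f (x, w)) has_field_derivative D) (at y)"
    "(\<lambda>k. (partial2 f (x + h k, y) - partial2 f (x, y)) / h k) \<longlonglongrightarrow> D"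
proof -
  obtain r where r: "r > 0" "cball x r \<times> cball y r \<subseteq> U"
    using open_contains_bicball[OF U xy] by metis
  \<comment> \<open>Nonzero steps tending to 0 and never longer than \<open>r\<close>, so that
    \<open>x + h k\<close> stays in the closed disc.\<close>
  define h where "h k = complex_of_real (r / real (Suc k))" for k
  have hr: "norm (h k) \<le> r" for k using r(1) by (simp add: h_def field_simps norm_divide flip: of_real_add of_nat_Suc)
  have h0: "h k \<noteq> 0" for k unfolding h_def of_real_eq_0_iff using r(1) by simp
  have lim: "h \<longlonglongrightarrow> 0"
  proof -
    have "(\<lambda>k. r / real (Suc k)) \<longlonglongrightarrow> 0"
      using lim_const_over_n[of r] LIMSEQ_Suc by blast
    then show ?thesis unfolding h_def using tendsto_of_real[of _ 0] by (metis of_real_0)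
  qed
  define F where "F k w = (f (x + h k, w) - f (x, w)) / h k" for k w
  define F' where "F' k w = (partial2 f (x + h k, w) - partial2 f (x, w)) / h k" for k w
  have inU: "(x + h k, w) \<in> U" "(x, w) \<in> U" if "w \<in> ball y r" for k w
    using that hr[of k] r by (auto simp: subset_iff dist_norm)
  have contp: "continuous_on U (partial1 f)"
    using holomorphic2_on_slice1[OF hol]
    by (intro continuous_on_partial1 holomorphic2_on_imp_continuous_on[OF hol] U) (auto simp: field_differentiable_def)
  have uc: "uniformly_continuous_on (cball x r \<times> cball y r) (partial1 f)"
    by (intro compact_uniformly_continuous continuous_on_subset[OF contp r(2)] compact_Times compact_cball)
  have unif: "uniform_limit (ball y r) F (\<lambda>w. partial1 f (x, w)) sequentially"
    unfolding uniform_limit_iff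
  proof (intro allI impI)
    fix e :: real assume "e > 0"
    then obtain d where d: "d > 0" "\<And>z z'. z \<in> cball x r \<times> cball y r \<Longrightarrow> z' \<in> cball x r \<times> cball y r
        \<Longrightarrow> dist z' z < d \<Longrightarrow> dist (partial1 f z') (partial1 f z) < e / 2"
      using uc unfolding uniformly_continuous_on_def by (metis half_gt_zero)
    have "\<forall>\<^sub>F k in sequentially. norm (h k) < d"
      using tendstoD[OF lim d(1)] by simp
    then show "\<forall>\<^sub>F k in sequentially. \<forall>w\<in>ball y r. dist (F k w) (partial1 f (x, w)) < e"
    proof (rule eventually_mono, intro ballI)
      fix k w assume hd: "norm (h k) < d" and w: "w \<in> ball y r"
      let ?B = "cball x (norm (h k))"
      \<comment> \<open>Mean value inequality for \<open>f\<close> minus its linear part. Uniform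
        continuity of \<open>partial1 f\<close> bounds the derivative by \<open>e / 2\<close>, with
        the same \<open>k\<close> for all \<open>w\<close>.\<close>
      have "norm ((f (x + h k, w) - partial1 f (x, w) * (x + h k)) - (f (x, w) - partial1 f (x, w) * x))
            \<le> e / 2 * norm (x + h k - x)"
      proof (rule field_differentiable_bound[where S = ?B])
        fix v assume v: "v \<in> ?B"
        have vw: "(v, w) \<in> cball x r \<times> cball y r" using v w hr[of k] by auto
        then have "((\<lambda>w'. f (w', w)) has_field_derivative partial1 f (v, w)) (at v)"
          using holomorphic2_on_slice1[OF hol] r(2) by blast
        then show "((\<lambda>v. f (v, w) - partial1 f (x, w) * v) has_field_derivative partial1 f (v, w) - partial1 f (x, w)) (at v within ?B)"
          by (auto intro!: derivative_eq_intros intro: has_field_derivative_at_within)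
        have "dist (partial1 f (v, w)) (partial1 f (x, w)) < e / 2"
          using d(2)[of "(x, w)" "(v, w)"] vw v hd w r(1) by (auto simp: dist_Pair_Pair dist_commute)
        then show "norm (partial1 f (v, w) - partial1 f (x, w)) \<le> e / 2" by (simp add: dist_norm)
      qed (auto simp: dist_norm)
      moreover have "(f (x + h k, w) - partial1 f (x, w) * (x + h k)) - (f (x, w) - partial1 f (x, w) * x)
           = h k * (F k w - partial1 f (x, w))"
        using h0[of k] by (simp add: F_def field_simps)
      ultimately have "norm (h k) * norm (F k w - partial1 f (x, w)) \<le> norm (h k) * (e / 2)"
        by (simp add: norm_mult mult.commute)
      then have "norm (F k w - partial1 f (x, w)) \<le> e / 2"
        using h0[of k] by simp
      then show "dist (F k w) (partial1 f (x, w)) < e" using \<open>e > 0\<close> by (simp add: dist_norm)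
    qed
  qed
  have "\<exists>g'. \<forall>w\<in>ball y r. ((\<lambda>w. partial1 f (x, w)) has_field_derivative (g' w)) (at w) \<and> ((\<lambda>k. F' k w) \<longlonglongrightarrow> g' w)"
  proof (rule has_complex_derivative_uniform_sequence)
    show "(F k has_field_derivative F' k w) (at w)" if "w \<in> ball y r" for k w
      unfolding F_def F'_def
      by (intro DERIV_cdivide DERIV_diff holomorphic2_on_slice2[OF hol] inU that)
    show "\<exists>d. 0 < d \<and> cball w d \<subseteq> ball y r \<and> uniform_limit (cball w d) F (\<lambda>w. partial1 f (x, w)) sequentially"
      if "w \<in> ball y r" for w
      using open_contains_cball_eq[OF open_ball] that uniform_limit_on_subset[OF unif] by metis
  qed auto
  then obtain D where "((\<lambda>w. partial1 f (x, w)) has_field_derivative D) (at y)" "(\<lambda>k. F' k y) \<longlonglongrightarrow> D"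
    using r(1) by (metis centre_in_ball)
  then show ?thesis using that lim h0 unfolding F'_def by blast
qed

lemma partial1_slice1:
  assumes hol: "holomorphic2_on f U" and U: "open U" and xy: "(x, y) \<in> U"
  shows "(\<lambda>w. partial1 f (w, y)) field_differentiable at x"
proof -
  have o: "open ((\<lambda>w. (w, y)) -` U)"
    by (rule continuous_open_vimage[OF U]) (auto intro!: continuous_intros)
  have "(\<lambda>w. f (w, y)) holomorphic_on ((\<lambda>w. (w, y)) -` U)"
    by (rule holomorphic2_on_imp_holomorphic_on_slice1[OF hol]) auto
  then have "deriv (\<lambda>w. f (w, y)) holomorphic_on ((\<lambda>w. (w, y)) -` U)"
    by (rule holomorphic_deriv[OF _ o])
  then show ?thesis
    using holomorphic_on_imp_differentiable_at[OF _ o] xy by (simp add: partial1_def[abs_def])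
qed

lemma holomorphic2_on_partial1:
  assumes hol: "holomorphic2_on f U" and U: "open U"
  shows "holomorphic2_on (partial1 f) U"
proof (rule osgood)
  show "continuous_on U (partial1 f)"
    using holomorphic2_on_slice1[OF hol]
    by (intro continuous_on_partial1 holomorphic2_on_imp_continuous_on[OF hol] U) (auto simp: field_differentiable_def)
  show "(\<lambda>w. partial1 f (w, y)) field_differentiable at x" if "(x, y) \<in> U" for x y
    by (rule partial1_slice1[OF hol U that])
  show "(\<lambda>w. partial1 f (x, w)) field_differentiable at y" if "(x, y) \<in> U" for x y
    using partial1_slice2[OF hol U that] by (metis field_differentiable_def)
qed (rule U)

lemma holomorphic2_on_partial2:
  assumes hol: "holomorphic2_on f U" and U: "open U"
  shows "holomorphic2_on (partial2 f) U"
proof -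
  have "holomorphic2_on (partial1 (\<lambda>z. f (prod.swap z))) (prod.swap -` U)"
    by (intro holomorphic2_on_partial1 holomorphic2_on_swap open_swap assms)
  then have "holomorphic2_on (\<lambda>z. partial1 (\<lambda>z. f (prod.swap z)) (prod.swap z)) (prod.swap -` (prod.swap -` U))"
    by (rule holomorphic2_on_swap)
  then show ?thesis by (simp add: partial_swap vimage_def)
qed

text \<open>Along the sequence from \<open>partial1_slice2\<close> the difference quotients of
  \<open>partial2 f\<close> tend to both mixed derivatives.\<close>

lemma mixed_partials:
  assumes hol: "holomorphic2_on f U" and U: "open U" and "z \<in> U"
  shows "partial1 (partial2 f) z = partial2 (partial1 f) z"
proof -
  obtain x y where z: "z = (x, y)" by (cases z)
  have xy: "(x, y) \<in> U" using assms z by simp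
  obtain h :: "nat \<Rightarrow> complex" and D where h: "h \<longlonglongrightarrow> 0" "\<And>k. h k \<noteq> 0"
    and D: "((\<lambda>w. partial1 f (x, w)) has_field_derivative D) (at y)"
    and lim: "(\<lambda>k. (partial2 f (x + h k, y) - partial2 f (x, y)) / h k) \<longlonglongrightarrow> D"
    using partial1_slice2[OF hol U xy] by blast
  have "((\<lambda>w. partial2 f (w, y)) has_field_derivative partial1 (partial2 f) (x, y)) (at x)"
    by (rule holomorphic2_on_slice1[OF holomorphic2_on_partial2[OF hol U] xy])
  then have "((\<lambda>h. (partial2 f (x + h, y) - partial2 f (x, y)) / h) \<longlongrightarrow> partial1 (partial2 f) (x, y)) (at 0)"
    by (simp add: DERIV_def)
  moreover have "filterlim h (at 0) sequentially"
    using h by (auto simp: filterlim_at)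
  ultimately have "(\<lambda>k. (partial2 f (x + h k, y) - partial2 f (x, y)) / h k) \<longlonglongrightarrow> partial1 (partial2 f) (x, y)"
    by (rule filterlim_compose)
  then have "D = partial1 (partial2 f) (x, y)" using lim LIMSEQ_unique by blast
  moreover have "partial2 (partial1 f) (x, y) = D"
    using D by (simp add: partial2_def DERIV_imp_deriv)
  ultimately show ?thesis by (simp add: z)
qed

section \<open>Singularities on complex lines\<close>

text \<open>The quotient by the first coordinate is continued to \<open>x = 0\<close> by the values
  of \<open>partial1 f\<close>. Osgood's lemma applies: continuity on the line comes from the mean
  value inequality, first slices have removable singularities, and on the line the second slice is
  one of the holomorphic function \<open>partial1 f\<close>.\<close>

lemma divide_by_coordinate:
  assumes r: "r > 0" and hol: "holomorphic2_on f (ball 0 r \<times> ball c s)"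
    and zero: "\<And>y. y \<in> ball c s \<Longrightarrow> f (0, y) = 0"
  obtains g where "holomorphic2_on g (ball 0 r \<times> ball c s)"
    "\<And>x y. x \<in> ball 0 r \<Longrightarrow> y \<in> ball c s \<Longrightarrow> f (x, y) = x * g (x, y)"
proof -
  define B where "B = ball (0::complex) r \<times> ball c s"
  have oB: "open B" unfolding B_def by (intro open_Times open_ball)
  note hol = hol[folded B_def]
  define g where "g z = (if fst z = 0 then partial1 f (0, snd z) else f z / fst z)" for z
  have holp: "holomorphic2_on (partial1 f) B" by (rule holomorphic2_on_partial1[OF hol oB])
  have away: "holomorphic2_on (\<lambda>z. f z / fst z) (B \<inter> {z. fst z \<noteq> 0})"
  proof (rule holomorphic2_on_divide)
    show "holomorphic2_on fst (B \<inter> {z. fst z \<noteq> 0})"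
      using holomorphic2_on_affine[of 1 0 0] by simp
  qed (auto intro: holomorphic2_on_subset[OF hol])
  have oaway: "open (B \<inter> {z. fst z \<noteq> 0})"
    by (intro open_Int oB open_Collect_neq continuous_intros)
  have holaway: "holomorphic2_on g (B \<inter> {z. fst z \<noteq> 0})"
    by (rule holomorphic2_on_cong[OF away oaway]) (auto simp: g_def)
  have "holomorphic2_on g B"
  proof (rule osgood)
    show "open B" by (rule oB)
    show "continuous_on B g"
    proof (rule continuous_at_imp_continuous_on, rule ballI)
      fix p assume "p \<in> B"
      obtain x0 y0 where p: "p = (x0, y0)" by (cases p)
      show "isCont g p"
      proof (cases "x0 = 0")
        case False
        then have "p \<in> B \<inter> {z. fst z \<noteq> 0}" using \<open>p \<in> B\<close> by (simp add: p)
        then show ?thesis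
          using holomorphic2_on_imp_continuous_on[OF holaway] continuous_on_eq_continuous_at[OF oaway] by blast
      next
        case True
        show ?thesis
          unfolding continuous_at_eps_delta
        proof (intro allI impI)
          fix e :: real assume "e > 0"
          have "isCont (partial1 f) p"
            using holomorphic2_on_imp_continuous_on[OF holp] continuous_on_eq_continuous_at[OF oB] \<open>p \<in> B\<close> by blast
          then obtain d1 where d1: "d1 > 0" "\<And>q. dist q p < d1 \<Longrightarrow> dist (partial1 f q) (partial1 f p) < e / 2"
            using \<open>e > 0\<close> unfolding continuous_at_eps_delta by (metis half_gt_zero)
          obtain d2 where d2: "d2 > 0" "ball p d2 \<subseteq> B" using oB \<open>p \<in> B\<close> openE by blast
          define d where "d = min d1 d2"
          have "dist (g q) (g p) < e" if q: "dist q p < d" for q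
          proof -
            obtain x y where xy: "q = (x, y)" by (cases q)
            \<comment> \<open>As \<open>fst p = 0\<close>, replacing \<open>x\<close> by a point
              \<open>v\<close> of the segment from 0 to \<open>x\<close> does not increase the
              distance to \<open>p\<close>.\<close>
            have near: "(v, y) \<in> B" "dist (partial1 f (v, y)) (partial1 f p) < e / 2" if "v \<in> closed_segment 0 x" for v
            proof -
              have "norm v \<le> norm x" using that segment_bound1[OF that] by simp
              then have "dist v 0 \<le> dist x 0" by (simp add: dist_norm)
              then have "(dist v 0)\<^sup>2 + (dist y y0)\<^sup>2 \<le> (dist x 0)\<^sup>2 + (dist y y0)\<^sup>2"
                by (intro add_right_mono power_mono) auto
              then have "dist (v, y) p \<le> dist q p"
                unfolding xy p True dist_Pair_Pair by (rule real_sqrt_le_mono)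
              then have "dist (v, y) p < d" using q by simp
              then show "(v, y) \<in> B" "dist (partial1 f (v, y)) (partial1 f p) < e / 2"
                using d1 d2 by (auto simp: d_def subset_iff dist_commute)
            qed
            show ?thesis
            proof (cases "x = 0")
              case True
              then show ?thesis
                using near(2)[of 0] \<open>x0 = 0\<close> \<open>e > 0\<close> by (simp add: g_def xy p)
            next
              case False
              \<comment> \<open>Since \<open>f (0, y) = 0\<close>, the difference on the left equals
                \<open>x * (g q - g p)\<close>; dividing by \<open>norm x\<close> gives the
                continuity estimate.\<close>
              have "norm ((f (x, y) - partial1 f p * x) - (f (0, y) - partial1 f p * 0)) \<le> e / 2 * norm (x - 0)"
              proof (rule field_differentiable_bound[where S = "closed_segment 0 x"])
                fix v assume v: "v \<in> closed_segment 0 x"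
                have "((\<lambda>v. f (v, y)) has_field_derivative partial1 f (v, y)) (at v)"
                  by (rule holomorphic2_on_slice1[OF hol near(1)[OF v]])
                then show "((\<lambda>v. f (v, y) - partial1 f p * v) has_field_derivative partial1 f (v, y) - partial1 f p)
                    (at v within closed_segment 0 x)"
                  by (auto intro!: derivative_eq_intros intro: has_field_derivative_at_within)
                show "norm (partial1 f (v, y) - partial1 f p) \<le> e / 2"
                  using near(2)[OF v] by (simp add: dist_norm)
              qed auto
              moreover have "f (0, y) = 0" using near(1)[of 0] zero by (simp add: B_def)
              moreover have "f (x, y) - partial1 f p * x = x * (g q - g p)"
                using False \<open>x0 = 0\<close> by (simp add: g_def xy p field_simps)
              ultimately have "norm x * norm (g q - g p) \<le> norm x * (e / 2)"
                by (simp add: norm_mult mult.commute)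
              then have "norm (g q - g p) \<le> e / 2" using False by simp
              then show ?thesis using \<open>e > 0\<close> by (simp add: dist_norm)
            qed
          qed
          then show "\<exists>d>0. \<forall>q. dist q p < d \<longrightarrow> dist (g q) (g p) < e"
            using d1(1) d2(1) by (intro exI[of _ d]) (auto simp: d_def)
        qed
      qed
    qed
    show "(\<lambda>w. g (w, y)) field_differentiable at x" if "(x, y) \<in> B" for x y
    proof -
      have y: "y \<in> ball c s" and x: "x \<in> ball 0 r" using that by (auto simp: B_def)
      have "(\<lambda>w. f (w, y)) holomorphic_on ball 0 r"
        by (rule holomorphic2_on_imp_holomorphic_on_slice1[OF hol]) (use y in \<open>auto simp: B_def\<close>)
      \<comment> \<open>Removable singularity in one variable, with the derivative as the value at
        the centre.\<close>
      from pole_lemma[OF this, of 0]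
      have "(\<lambda>w. g (w, y)) holomorphic_on ball 0 r"
        using r zero[OF y] by (simp add: g_def partial1_def cong: if_cong)
      then show ?thesis using x holomorphic_on_imp_differentiable_at open_ball by blast
    qed
    show "(\<lambda>w. g (x, w)) field_differentiable at y" if "(x, y) \<in> B" for x y
    proof (cases "x = 0")
      case True
      then show ?thesis
        using holomorphic2_on_slice2[OF holp that] by (auto simp: g_def field_differentiable_def)
    next
      case False
      then show ?thesis
        using holomorphic2_on_slice2[OF away, of x y] that by (auto simp: g_def field_differentiable_def)
    qed
  qed
  then show ?thesis
    using that[of g] zero by (auto simp: B_def g_def)
qed

section \<open>Reduced local fractions along a coordinate line\<close>

text \<open>Agreement is asked only at regular points of \<open>u\<close>: elsewhere in
  \<open>U\<close> the values of \<open>u\<close> carry no information, and \<open>f\<close>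
  replaces them.\<close>

definition holomorphic2_extension ::
  "(complex \<times> complex \<Rightarrow> complex) \<Rightarrow> (complex \<times> complex \<Rightarrow> complex) \<Rightarrow> (complex \<times> complex) set \<Rightarrow> bool" where
  "holomorphic2_extension u f U \<longleftrightarrow>
     open U \<and> holomorphic2_on f U \<and> (\<forall>z\<in>U \<inter> regular_points u. u z = f z)"

text \<open>The multiplicative form makes sense where \<open>h\<close> vanishes and is stable under
  cancelling a common factor. Whether \<open>h\<close> vanishes identically on the line
  \<open>fst z = 0\<close> is left open; removing that case is the purpose of the reduction
  below.\<close>

definition local_fraction where
  "local_fraction u g h c r \<longleftrightarrow> 0 < r \<and> holomorphic2_on g (ball 0 r \<times> ball c r) \<and>
     holomorphic2_on h (ball 0 r \<times> ball c r) \<and>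
     (\<forall>z\<in>(ball 0 r \<times> ball c r) \<inter> regular_points u. u z * h z = g z)"

lemma holomorphic_on_coordinate_line:
  assumes "holomorphic2_on f (ball 0 r \<times> ball c r)" "r > 0"
  shows "(\<lambda>y. f (0, y)) holomorphic_on ball c r"
  by (rule holomorphic2_on_imp_holomorphic_on_slice2[OF assms(1)]) (use assms in auto)

text \<open>Two fractions of \<open>u\<close> satisfy \<open>g * h1 = g1 * h\<close> on their
  overlap. On the line the right side is 0 while \<open>h1\<close> is not identically 0, so
  \<open>g\<close> vanishes on an open piece of the line and hence throughout the disc.\<close>

lemma local_fraction_vanishing:
  assumes mero: "meromorphic2_on u UNIV"
    and gh: "local_fraction u g h c r" and gh1: "local_fraction u g1 h1 c1 r1"
    and y1: "y1 \<in> ball c r \<inter> ball c1 r1" and h1: "\<exists>y\<in>ball c1 r1. h1 (0, y) \<noteq> 0"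
    and h0: "\<And>y. y \<in> ball c r \<Longrightarrow> h (0, y) = 0" and y: "y \<in> ball c r"
  shows "g (0, y) = 0"
proof -
  note gh = gh[unfolded local_fraction_def] and gh1 = gh1[unfolded local_fraction_def]
  let ?B = "ball 0 r \<times> ball c r" and ?B1 = "ball 0 r1 \<times> ball c1 r1"
  let ?I = "ball c r \<inter> ball c1 r1"
  have sub: "holomorphic2_on f (?B \<inter> ?B1)" if "holomorphic2_on f ?B \<or> holomorphic2_on f ?B1" for f
    using that holomorphic2_on_subset by blast
  have cross: "g z * h1 z = g1 z * h z" if "z \<in> ?B \<inter> ?B1" for z
  proof (rule eq_on_dense[where R = "regular_points u"])
    show "continuous_on (?B \<inter> ?B1) (\<lambda>z. g z * h1 z)" "continuous_on (?B \<inter> ?B1) (\<lambda>z. g1 z * h z)"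
      using gh gh1 by (intro holomorphic2_on_imp_continuous_on holomorphic2_on_mult sub; blast)+
    show "g z * h1 z = g1 z * h z" if "z \<in> ?B \<inter> ?B1 \<inter> regular_points u" for z
    proof -
      have "u z * h z = g z" "u z * h1 z = g1 z" using that gh gh1 by blast+
      then show ?thesis by (metis mult.assoc mult.commute)
    qed
  qed (use that dense_regular_points[OF mero] in \<open>auto intro!: open_Int open_Times\<close>)
  have hol1: "(\<lambda>y. h1 (0, y)) holomorphic_on ball c1 r1"
    using gh1 holomorphic_on_coordinate_line by blast
  \<comment> \<open>Vanishing on the overlap would force \<open>h1\<close> to vanish on its whole
    disc of the line.\<close>
  obtain y2 where y2: "y2 \<in> ?I" "h1 (0, y2) \<noteq> 0"
    using analytic_continuation_open[of ?I "ball c1 r1" "\<lambda>y. h1 (0, y)" "\<lambda>_. 0"] y1 h1 hol1 by fastforce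
  let ?J = "ball c r \<inter> {y \<in> ball c1 r1. h1 (0, y) \<noteq> 0}"
  show ?thesis
  proof (rule analytic_continuation_open[of ?J "ball c r" "\<lambda>y. g (0, y)" "\<lambda>_. 0"])
    show "open ?J" by (intro open_Int open_ball open_nonzero holomorphic_on_imp_continuous_on hol1)
    show "?J \<noteq> {}" using y2 by blast
    show "(\<lambda>y. g (0, y)) holomorphic_on ball c r" using gh holomorphic_on_coordinate_line by blast
    show "g (0, y) = 0" if "y \<in> ?J" for y
    proof -
      have "(0, y) \<in> ?B \<inter> ?B1" using that gh gh1 by auto
      then show ?thesis using cross[of "(0, y)"] h0 that by auto
    qed
  qed (use y in auto)
qed

text \<open>Common factors of numerator and denominator along the line \<^term>\<open>{0} \<times> UNIV\<close> are divided
  out one at a time; the order of vanishing \<^term>\<open>k\<close> of \<^term>\<open>h\<close> at \<^term>\<open>(0, b)\<close> in the first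
  variable drops in each step.\<close>

lemma reduce_local_fraction:
  assumes mero: "meromorphic2_on u UNIV"
    and gh1: "local_fraction u g1 h1 c1 r1"
    and y1: "y1 \<in> ball c r \<inter> ball c1 r1" and h1: "\<exists>y\<in>ball c1 r1. h1 (0, y) \<noteq> 0"
    and b: "b \<in> ball c r"
    and F: "(F \<longlongrightarrow> l) (at 0)" "l \<noteq> 0"
  shows "local_fraction u g h c r \<Longrightarrow> \<forall>\<^sub>F x in at 0. h (x, b) = x ^ k * F x \<Longrightarrow>
    \<exists>g' h'. local_fraction u g' h' c r \<and> (\<exists>y\<in>ball c r. h' (0, y) \<noteq> 0)"
proof (induction k arbitrary: g h)
  case 0
  let ?B = "ball 0 r \<times> ball c r"
  have r: "r > 0" and holh: "holomorphic2_on h ?B" using 0 unfolding local_fraction_def by blast+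
  \<comment> \<open>With exponent 0 the slice tends to \<open>l\<close>, so
    \<open>h (0, b) = l\<close> is nonzero and nothing is left to divide out.\<close>
  have "((\<lambda>w. h (w, b)) has_field_derivative partial1 h (0, b)) (at 0)"
    using holomorphic2_on_slice1[OF holh, of 0 b] r b by simp
  then have "((\<lambda>w. h (w, b)) \<longlongrightarrow> h (0, b)) (at 0)"
    using DERIV_isCont isContD by blast
  moreover have "((\<lambda>w. h (w, b)) \<longlongrightarrow> l) (at 0)"
    by (rule Lim_transform_eventually[OF F(1)]) (use 0(2) in \<open>auto elim: eventually_mono\<close>)
  ultimately have "h (0, b) = l" using tendsto_unique[of "at (0::complex)"] by force
  then show ?case using 0 b F(2) by blast
next
  case (Suc k)
  let ?B = "ball 0 r \<times> ball c r"
  note gh = Suc.prems(1)[unfolded local_fraction_def]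
  show ?case
  proof (cases "\<exists>y\<in>ball c r. h (0, y) \<noteq> 0")
    case True
    then show ?thesis using Suc.prems(1) by blast
  next
    case False
    then have h0: "\<And>y. y \<in> ball c r \<Longrightarrow> h (0, y) = 0" by blast
    have r: "r > 0" using gh by blast
    have g0: "\<And>y. y \<in> ball c r \<Longrightarrow> g (0, y) = 0"
      using local_fraction_vanishing[OF mero Suc.prems(1) gh1 y1 h1 h0] by blast
    obtain h' where h': "holomorphic2_on h' ?B" "\<And>x y. x \<in> ball 0 r \<Longrightarrow> y \<in> ball c r \<Longrightarrow> h (x, y) = x * h' (x, y)"
      using divide_by_coordinate[OF r, of h c r] gh h0 by blast
    obtain g' where g': "holomorphic2_on g' ?B" "\<And>x y. x \<in> ball 0 r \<Longrightarrow> y \<in> ball c r \<Longrightarrow> g (x, y) = x * g' (x, y)"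
      using divide_by_coordinate[OF r, of g c r] gh g0 by blast
    \<comment> \<open>Off the line the factor \<open>fst z\<close> cancels. The complement of the
      line is dense, so the identity extends to the line by continuity.\<close>
    have uh: "u z * h' z = g' z" if "z \<in> ?B \<inter> regular_points u" for z
    proof (rule eq_on_dense[where U = "?B \<inter> regular_points u" and R = "{z. fst z \<noteq> 0}"])
      show "continuous_on (?B \<inter> regular_points u) (\<lambda>z. u z * h' z)"
        by (intro holomorphic2_on_imp_continuous_on holomorphic2_on_mult
             holomorphic2_on_subset[OF h'(1)] holomorphic2_on_subset[OF holomorphic2_on_regular_points]) auto
      show "continuous_on (?B \<inter> regular_points u) g'"
        by (intro holomorphic2_on_imp_continuous_on holomorphic2_on_subset[OF g'(1)]) auto
      show "open (?B \<inter> regular_points u)"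
        by (intro open_Int open_Times open_ball open_regular_points)
      show "V \<inter> {z. fst z \<noteq> 0} \<noteq> {}" if "open V" "V \<noteq> {}" for V :: "(complex \<times> complex) set"
      proof -
        obtain x y where "(x, y) \<in> V" using \<open>V \<noteq> {}\<close> by auto
        then obtain A B where "open A" "x \<in> A" "y \<in> B" "A \<times> B \<subseteq> V"
          using open_prod_elim[OF \<open>open V\<close>] by (metis mem_Sigma_iff)
        moreover have "A \<noteq> {0}" using \<open>open A\<close> not_open_singleton by metis
        ultimately show ?thesis by fastforce
      qed
      show "u z * h' z = g' z" if z: "z \<in> ?B \<inter> regular_points u \<inter> {z. fst z \<noteq> 0}" for z
      proof -
        have "u z * h z = g z" using gh z by blast
        then show ?thesis using h'(2)[of "fst z" "snd z"] g'(2)[of "fst z" "snd z"] z by auto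
      qed
    qed (use that in auto)
    show ?thesis
    proof (rule Suc.IH)
      show "local_fraction u g' h' c r"
        unfolding local_fraction_def using r h' g' uh by blast
      have "\<forall>\<^sub>F x in at (0::complex). x \<in> ball 0 r - {0}"
        using r by (intro eventually_at_in_open) auto
      with Suc.prems(2) show "\<forall>\<^sub>F x in at 0. h' (x, b) = x ^ k * F x"
        by eventually_elim (use h'(2)[OF _ b] in auto)
    qed
  qed
qed

text \<open>\<open>k\<close> is the order of the zero at 0 and bounds the number of reductions. Only
  the limit of \<open>F\<close> matters, since the factorization is used at points near 0 other than
  0.\<close>

lemma factor_zero:
  fixes f :: "complex \<Rightarrow> complex"
  assumes "f holomorphic_on ball 0 r" "r > 0" "\<exists>x\<in>ball 0 r. f x \<noteq> 0"
  obtains k F l where "\<forall>\<^sub>F x in at 0. f x = x ^ k * F x" "(F \<longlongrightarrow> l) (at 0)" "l \<noteq> 0"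
proof (cases "f 0 = 0")
  case False
  have "isCont f 0"
    using assms continuous_on_eq_continuous_at[OF open_ball] holomorphic_on_imp_continuous_on
    by (metis centre_in_ball)
  then show ?thesis using that[of 0 f "f 0"] False isContD by auto
next
  case True
  have "\<not> f constant_on ball 0 r" using True assms unfolding constant_on_def by (metis centre_in_ball)
  then obtain g s n where g: "0 < s" "g holomorphic_on ball 0 s" "\<And>w. w \<in> ball 0 s \<Longrightarrow> f w = (w - 0) ^ n * g w"
      "\<And>w. w \<in> ball 0 s \<Longrightarrow> g w \<noteq> 0"
    using holomorphic_factor_zero_nonconstant[OF assms(1) open_ball connected_ball, of 0] assms(2) True
    by (metis centre_in_ball)
  have "isCont g 0"
    using g continuous_on_eq_continuous_at[OF open_ball] holomorphic_on_imp_continuous_on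
    by (metis centre_in_ball)
  moreover have "\<forall>\<^sub>F x in at 0. f x = x ^ n * g x"
    using eventually_at_in_open'[of "ball 0 s" 0] g by (auto elim!: eventually_mono)
  ultimately show ?thesis using that[of n g "g 0"] g(1,4) isContD by auto
qed

text \<open>A clopen argument on the line: fractions whose denominator is not identically 0 on the
  line spread from the regular point \<open>(0, b)\<close> to every point. The zeros of such a
  denominator on the line are isolated, and elsewhere the quotient extends \<open>u\<close>.\<close>

lemma extension_along_coordinate_line:
  assumes mero: "meromorphic2_on u UNIV" and b: "(0, b) \<in> regular_points u"
  shows "\<forall>\<^sub>F y' in at y. \<exists>f U. (0, y') \<in> U \<and> holomorphic2_extension u f U"
proof -
  define S where "S = {y. \<exists>g h c r. y \<in> ball c r \<and> local_fraction u g h c r \<and> (\<exists>y\<in>ball c r. h (0, y) \<noteq> 0)}"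
  have "open S"
    unfolding S_def by (subst open_subopen) (use open_ball in blast)
  moreover have "b \<in> S"
  proof -
    obtain r where r: "r > 0" "cball 0 r \<times> cball b r \<subseteq> regular_points u"
      using open_contains_bicball[OF open_regular_points b] by metis
    have "holomorphic2_on u (ball 0 r \<times> ball b r)"
      by (rule holomorphic2_on_subset[OF holomorphic2_on_regular_points]) (use r in auto)
    then have "local_fraction u u (\<lambda>_. 1) b r"
      using r holomorphic2_on_affine[of 0 0 1] by (simp add: local_fraction_def)
    then have "\<exists>h. b \<in> ball b r \<and> local_fraction u u h b r \<and> (\<exists>y\<in>ball b r. h (0, y) \<noteq> 0)"
      using r(1) by (intro exI[of _ "\<lambda>_. 1"] conjI bexI[of _ b]) simp_all
    then show ?thesis unfolding S_def by blast
  qed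
  moreover have "closed S"
    unfolding closed_limpt
  proof (intro allI impI)
    fix y assume y: "y islimpt S"
    obtain U g h where U: "open U" "connected U" "(0, y) \<in> U"
        and g: "holomorphic2_on g U" and h: "holomorphic2_on h U" and hz: "\<exists>z\<in>U. h z \<noteq> 0"
        and u: "\<forall>z\<in>U. h z \<noteq> 0 \<longrightarrow> u z = g z / h z"
      using mero[unfolded meromorphic2_on_def, rule_format, of "(0, y)"] by auto
    have nz: "\<exists>w\<in>V. h w \<noteq> 0" if "open V" "V \<subseteq> U" "V \<noteq> {}" for V
      using holomorphic2_eq_0[OF h U(1,2) that] hz by blast
    obtain r where r: "r > 0" "cball 0 r \<times> cball y r \<subseteq> U"
      using open_contains_bicball[OF U(1,3)] by metis
    let ?B = "ball 0 r \<times> ball y r"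
    have B: "?B \<subseteq> U" "open ?B" using r by (auto simp: subset_iff intro!: open_Times)
    \<comment> \<open>The equation is known where \<open>h\<close> is nonzero. Allowing also the
      points outside \<open>U\<close> makes the set \<open>R\<close> dense in the whole space, as
      \<open>eq_on_dense\<close> demands.\<close>
    have uh: "u z * h z = g z" if "z \<in> ?B \<inter> regular_points u" for z
    proof (rule eq_on_dense[where U = "?B \<inter> regular_points u" and R = "{z. z \<notin> U \<or> h z \<noteq> 0}"])
      show "continuous_on (?B \<inter> regular_points u) (\<lambda>z. u z * h z)"
        using B by (intro holomorphic2_on_imp_continuous_on holomorphic2_on_mult
             holomorphic2_on_subset[OF h] holomorphic2_on_subset[OF holomorphic2_on_regular_points]) auto
      show "continuous_on (?B \<inter> regular_points u) g"
        using B by (intro holomorphic2_on_imp_continuous_on holomorphic2_on_subset[OF g]) auto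
      show "open (?B \<inter> regular_points u)"
        using B by (intro open_Int open_regular_points)
      show "V \<inter> {z. z \<notin> U \<or> h z \<noteq> 0} \<noteq> {}" if "open V" "V \<noteq> {}" for V
        using nz[OF that(1) _ that(2)] that by blast
      show "u z * h z = g z" if "z \<in> ?B \<inter> regular_points u \<inter> {z. z \<notin> U \<or> h z \<noteq> 0}" for z
        using that u B by auto
    qed (use that in auto)
    have gh: "local_fraction u g h y r"
      unfolding local_fraction_def using r(1) B uh holomorphic2_on_subset[OF g] holomorphic2_on_subset[OF h] by blast
    obtain y1 where "y1 \<in> S" "y1 \<in> ball y r"
      using y r(1) unfolding islimpt_def by (meson open_ball centre_in_ball)
    then obtain g1 h1 c1 r1 where gh1: "y1 \<in> ball y r \<inter> ball c1 r1" "local_fraction u g1 h1 c1 r1"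
        "\<exists>y\<in>ball c1 r1. h1 (0, y) \<noteq> 0" unfolding S_def by blast
    \<comment> \<open>A point where \<open>h\<close> is nonzero selects a slice on which
      \<open>h\<close> has a zero of finite order at 0. A fraction around the nearby point
      \<open>y1\<close> of \<open>S\<close> then allows the reduction at \<open>y\<close>.\<close>
    obtain a b where ab: "a \<in> ball 0 r" "b \<in> ball y r" "h (a, b) \<noteq> 0"
      using nz[of ?B] B r(1) by fastforce
    have holb: "(\<lambda>w. h (w, b)) holomorphic_on ball 0 r"
      by (rule holomorphic2_on_imp_holomorphic_on_slice1[OF h]) (use B ab in auto)
    have "\<exists>x\<in>ball 0 r. h (x, b) \<noteq> 0" using ab by blast
    then obtain k F l where F: "\<forall>\<^sub>F x in at 0. h (x, b) = x ^ k * F x" "(F \<longlongrightarrow> l) (at 0)" "l \<noteq> 0"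
      by (rule factor_zero[OF holb r(1)])
    have "\<exists>g' h'. local_fraction u g' h' y r \<and> (\<exists>y\<in>ball y r. h' (0, y) \<noteq> 0)"
      by (rule reduce_local_fraction[OF mero gh1(2,1,3) ab(2) F(2,3) gh F(1)])
    moreover have "y \<in> ball y r" using r(1) by simp
    ultimately show "y \<in> S" unfolding S_def by blast
  qed
  ultimately have "S = UNIV"
    using connected_UNIV[where 'a = complex] clopen by blast
  then obtain g h c r where gh: "y \<in> ball c r" "local_fraction u g h c r" "\<exists>y\<in>ball c r. h (0, y) \<noteq> 0"
    unfolding S_def by blast
  note lf = gh(2)[unfolded local_fraction_def]
  have "(\<lambda>y. h (0, y)) holomorphic_on ball c r"
    using lf holomorphic_on_coordinate_line by blast
  then have "\<forall>\<^sub>F y' in at y. h (0, y') \<noteq> 0 \<and> y' \<in> ball c r"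
    using non_zero_neighbour_alt[of "\<lambda>y. h (0, y)" "ball c r" y] gh by blast
  then show ?thesis
  proof (rule eventually_mono)
    fix y' assume y': "h (0, y') \<noteq> 0 \<and> y' \<in> ball c r"
    let ?B = "ball 0 r \<times> ball c r"
    let ?W = "{z \<in> ?B. h z \<noteq> 0}"
    have "open ?W"
      using lf by (intro open_nonzero holomorphic2_on_imp_continuous_on open_Times) auto
    moreover have "holomorphic2_on (\<lambda>z. g z / h z) ?W"
      using lf by (intro holomorphic2_on_divide) (auto elim: holomorphic2_on_subset)
    moreover have "u z = g z / h z" if "z \<in> ?W \<inter> regular_points u" for z
      using lf that by (auto simp: field_simps)
    ultimately have "holomorphic2_extension u (\<lambda>z. g z / h z) ?W"
      unfolding holomorphic2_extension_def by blast
    then show "\<exists>f U. (0, y') \<in> U \<and> holomorphic2_extension u f U"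
      using y' lf by (intro exI[of _ "\<lambda>z. g z / h z"] exI[of _ ?W]) auto
  qed
qed

section \<open>Maximal representatives\<close>

lemma holomorphic2_extension_unique:
  assumes "meromorphic2_on u UNIV" "holomorphic2_extension u f U" "holomorphic2_extension u g V" "z \<in> U" "z \<in> V"
  shows "f z = g z"
proof (rule eq_on_dense[where U = "U \<inter> V" and R = "regular_points u"])
  show "continuous_on (U \<inter> V) f" "continuous_on (U \<inter> V) g"
    using assms(2,3) unfolding holomorphic2_extension_def
    by (meson holomorphic2_on_imp_continuous_on holomorphic2_on_subset inf_le1 inf_le2)+
  show "open (U \<inter> V)" using assms unfolding holomorphic2_extension_def by blast
  show "f z = g z" if "z \<in> U \<inter> V \<inter> regular_points u" for z
    using assms(2,3) that unfolding holomorphic2_extension_def by (metis IntD1 IntD2 IntI)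
qed (use assms dense_regular_points in auto)

text \<open>A representative may carry junk values on part of the zero set of a local denominator, for
  instance on a disc inside a complex line, even where the meromorphic function is holomorphic. Then
  the points of a line that are not regular need not be isolated, so such values have to be repaired.\<close>

definition maximal_representative :: "(complex \<times> complex \<Rightarrow> complex) \<Rightarrow> bool" where
  "maximal_representative u \<longleftrightarrow> (\<forall>f U. holomorphic2_extension u f U \<longrightarrow> U \<subseteq> regular_points u)"

text \<open>All extensions of \<open>u\<close> agree on overlaps, so \<open>v\<close> can take their
  common value wherever one exists and an arbitrary value elsewhere. Any extension of
  \<open>v\<close> is again one of \<open>u\<close>, which gives maximality.\<close>

lemma ex_maximal_representative:
  assumes mero: "meromorphic2_on u UNIV"
  obtains v where "meromorphic2_on v UNIV" "maximal_representative v"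
    "regular_points u \<subseteq> regular_points v" "\<And>z. z \<in> regular_points u \<Longrightarrow> v z = u z"
proof -
  define v where "v z = (SOME c. \<exists>f U. z \<in> U \<and> holomorphic2_extension u f U \<and> c = f z)" for z
  have v_eq: "v z = f z" if "holomorphic2_extension u f U" "z \<in> U" for f U z
  proof -
    have "\<exists>f U. z \<in> U \<and> holomorphic2_extension u f U \<and> v z = f z"
      unfolding v_def by (rule someI_ex) (use that in blast)
    then show ?thesis using holomorphic2_extension_unique[OF mero] that by metis
  qed
  have reg: "U \<subseteq> regular_points v" if "holomorphic2_extension u f U" for f U
  proof (rule regular_pointsI)
    show "open U" using that unfolding holomorphic2_extension_def by blast
    show "holomorphic2_on v U"
      by (rule holomorphic2_on_cong[of f]) (use that v_eq[OF that] in \<open>auto simp: holomorphic2_extension_def\<close>)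
  qed
  have self: "holomorphic2_extension u u (regular_points u)"
    unfolding holomorphic2_extension_def using open_regular_points holomorphic2_on_regular_points by blast
  show ?thesis
  proof
    show sub: "regular_points u \<subseteq> regular_points v" by (rule reg[OF self])
    show v_u: "v z = u z" if "z \<in> regular_points u" for z by (rule v_eq[OF self that])
    show "maximal_representative v"
      unfolding maximal_representative_def
    proof (intro allI impI)
      fix f U assume "holomorphic2_extension v f U"
      then have "holomorphic2_extension u f U"
        using sub v_u unfolding holomorphic2_extension_def by (metis IntD1 IntD2 IntI subsetD)
      then show "U \<subseteq> regular_points v" by (rule reg)
    qed
    show "meromorphic2_on v UNIV"
      unfolding meromorphic2_on_def
    proof
      fix p
      obtain U g h where U: "open U" "connected U" "p \<in> U"
          and g: "holomorphic2_on g U" and h: "holomorphic2_on h U" and hz: "\<exists>z\<in>U. h z \<noteq> 0"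
          and u: "\<forall>z\<in>U. h z \<noteq> 0 \<longrightarrow> u z = g z / h z"
        using mero[unfolded meromorphic2_on_def, rule_format, of p] by auto
      let ?W = "{z \<in> U. h z \<noteq> 0}"
      have "open ?W" by (intro open_nonzero holomorphic2_on_imp_continuous_on[OF h] U)
      moreover have "holomorphic2_on (\<lambda>z. g z / h z) ?W"
        by (intro holomorphic2_on_divide holomorphic2_on_subset[OF g] holomorphic2_on_subset[OF h]) auto
      ultimately have "holomorphic2_extension u (\<lambda>z. g z / h z) ?W"
        unfolding holomorphic2_extension_def using u by blast
      from v_eq[OF this] have "\<forall>z\<in>U. h z \<noteq> 0 \<longrightarrow> v z = g z / h z" by blast
      then show "\<exists>U g h. open U \<and> connected U \<and> p \<in> U \<and> holomorphic2_on g U \<and> holomorphic2_on h U \<and>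
          (\<exists>z\<in>U. h z \<noteq> 0) \<and> (\<forall>z\<in>U. h z \<noteq> 0 \<longrightarrow> v z = g z / h z)"
        using U g h hz by blast
    qed
  qed
qed

section \<open>Continuation along arbitrary complex lines\<close>

text \<open>A linear change of coordinates reduces this to the coordinate line. There extensions
  exist off isolated points; pulled back they extend \<open>u\<close>, and maximality turns their
  domains into regular points.\<close>

lemma sparse_singularities_on_line:
  assumes mero: "meromorphic2_on u UNIV" and max: "maximal_representative u"
    and b: "(z1 + b * v1, z2 + b * v2) \<in> regular_points u" and v: "v1 \<noteq> 0 \<or> v2 \<noteq> 0"
  shows "{c. (z1 + c * v1, z2 + c * v2) \<notin> regular_points u} sparse_in UNIV"
proof -
  \<comment> \<open>A second vector completing the direction \<open>(v1, v2)\<close> to a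
    basis.\<close>
  obtain e1 e2 where "e1 * v2 - v1 * e2 \<noteq> 0"
  proof (cases "v1 = 0")
    case True
    then show ?thesis using v that[of 1 0] by simp
  next
    case False
    then show ?thesis using that[of 0 1] by simp
  qed
  define d where "d = e1 * v2 - v1 * e2"
  have d: "d \<noteq> 0" using \<open>e1 * v2 - v1 * e2 \<noteq> 0\<close> by (simp add: d_def)
  define T where "T z = (e1 * fst z + v1 * snd z + z1, e2 * fst z + v2 * snd z + z2)" for z
  \<comment> \<open>The inverse of \<open>T\<close> by Cramer's rule, with determinant
    \<open>d\<close>.\<close>
  define T' where "T' z = ((v2 / d) * fst z + (- v1 / d) * snd z + (v1 * z2 - v2 * z1) / d,
                           (- e2 / d) * fst z + (e1 / d) * snd z + (e2 * z1 - e1 * z2) / d)" for z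
  have T'T: "T' (T z) = z" for z
  proof -
    have "fst (T' (T z)) = (e1 * v2 - v1 * e2) * fst z / d"
      unfolding T_def T'_def fst_conv snd_conv by (simp add: add_divide_distrib diff_divide_distrib algebra_simps)
    moreover have "snd (T' (T z)) = (e1 * v2 - v1 * e2) * snd z / d"
      unfolding T_def T'_def fst_conv snd_conv by (simp add: add_divide_distrib diff_divide_distrib algebra_simps)
    ultimately show ?thesis using d by (simp add: prod_eq_iff flip: d_def)
  qed
  have TT': "T (T' z) = z" for z
  proof -
    have "fst (T (T' z)) = (e1 * v2 - v1 * e2) * (fst z - z1) / d + z1"
      unfolding T_def T'_def fst_conv snd_conv by (simp add: add_divide_distrib diff_divide_distrib algebra_simps)
    moreover have "snd (T (T' z)) = (e1 * v2 - v1 * e2) * (snd z - z2) / d + z2"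
      unfolding T_def T'_def fst_conv snd_conv by (simp add: add_divide_distrib diff_divide_distrib algebra_simps)
    ultimately show ?thesis using d by (simp add: prod_eq_iff flip: d_def)
  qed
  have contT: "continuous_on UNIV T" and contT': "continuous_on UNIV T'"
    unfolding T_def T'_def by (intro continuous_intros)+
  have openT: "open (T -` U)" and openT': "open (T' -` U)" if "open U" for U
    using that contT contT' by (auto intro: open_vimage)
  have holT: "holomorphic2_on (\<lambda>z. f (T z)) (T -` U)" if "holomorphic2_on f U" for f U
    unfolding T_def by (rule holomorphic2_on_compose_affine[OF that]) (auto simp: T_def)
  have holT': "holomorphic2_on (\<lambda>z. f (T' z)) (T' -` U)" if "holomorphic2_on f U" for f U
    unfolding T'_def by (rule holomorphic2_on_compose_affine[OF that]) (auto simp: T'_def)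
  define w where "w z = u (T z)" for z
  have reg_w: "T z \<in> regular_points u \<Longrightarrow> z \<in> regular_points w" for z
    using regular_pointsI[OF openT[OF open_regular_points] holT[OF holomorphic2_on_regular_points], of u]
    by (auto simp: w_def[abs_def])
  have mero_w: "meromorphic2_on w UNIV"
    unfolding meromorphic2_on_def
  proof
    fix p
    obtain U g h where U: "open U" "connected U" "T p \<in> U"
        and g: "holomorphic2_on g U" and h: "holomorphic2_on h U" and hz: "\<exists>z\<in>U. h z \<noteq> 0"
        and u: "\<forall>z\<in>U. h z \<noteq> 0 \<longrightarrow> u z = g z / h z"
      using mero[unfolded meromorphic2_on_def, rule_format, of "T p"] by auto
    have "T -` U = T' ` U"
    proof (intro equalityI subsetI)
      fix z assume "z \<in> T -` U"
      then show "z \<in> T' ` U" using T'T[of z] by (intro image_eqI[of z T' "T z"]) auto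
    next
      fix z assume "z \<in> T' ` U"
      then show "z \<in> T -` U" using TT' by auto
    qed
    then have "connected (T -` U)"
      using connected_continuous_image[OF continuous_on_subset[OF contT'] U(2)] by simp
    moreover have "\<exists>z\<in>T -` U. h (T z) \<noteq> 0" using hz TT' by (metis vimageI)
    ultimately show "\<exists>U g h. open U \<and> connected U \<and> p \<in> U \<and> holomorphic2_on g U \<and> holomorphic2_on h U \<and>
          (\<exists>z\<in>U. h z \<noteq> 0) \<and> (\<forall>z\<in>U. h z \<noteq> 0 \<longrightarrow> w z = g z / h z)"
      using U u openT[OF U(1)] holT[OF g] holT[OF h]
      by (intro exI[of _ "T -` U"] exI[of _ "\<lambda>z. g (T z)"] exI[of _ "\<lambda>z. h (T z)"]) (auto simp: w_def)
  qed
  have line: "T (0, c) = (z1 + c * v1, z2 + c * v2)" for c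
    by (simp add: T_def add.commute mult.commute)
  have "\<forall>\<^sub>F c in at y. (z1 + c * v1, z2 + c * v2) \<in> regular_points u" for y
  proof -
    have "\<forall>\<^sub>F c in at y. \<exists>f U. (0, c) \<in> U \<and> holomorphic2_extension w f U"
      by (rule extension_along_coordinate_line[OF mero_w, of b]) (use b line reg_w in auto)
    then show ?thesis
    proof (rule eventually_mono)
      fix c assume "\<exists>f U. (0, c) \<in> U \<and> holomorphic2_extension w f U"
      then obtain f U where U: "(0, c) \<in> U" and f: "holomorphic2_extension w f U" by blast
      have "holomorphic2_extension u (\<lambda>z. f (T' z)) (T' -` U)"
        using f holT'[of f U] openT'[of U] reg_w TT' unfolding holomorphic2_extension_def w_def
        by (metis IntD1 IntD2 IntI vimageD)
      then have "T' -` U \<subseteq> regular_points u" using max unfolding maximal_representative_def by blast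
      then show "(z1 + c * v1, z2 + c * v2) \<in> regular_points u"
        using U T'T line by (metis subsetD vimageI)
    qed
  qed
  then show ?thesis by (simp add: sparse_in_eventually_iff)
qed

text \<open>Removing a sparse set leaves the parameter plane connected, so the identity theorem
  passes around the singularities.\<close>

lemma constant_along_line:
  fixes f :: "complex \<times> complex \<Rightarrow> complex"
  assumes mero: "meromorphic2_on u UNIV" and max: "maximal_representative u" and v: "v1 \<noteq> 0 \<or> v2 \<noteq> 0"
    and f: "holomorphic2_on f (regular_points u)"
    and S: "open S" "S \<noteq> {}" "\<And>c. c \<in> S \<Longrightarrow> (z1 + c * v1, z2 + c * v2) \<in> regular_points u"
      "\<And>c. c \<in> S \<Longrightarrow> f (z1 + c * v1, z2 + c * v2) = l"
    and c: "(z1 + c * v1, z2 + c * v2) \<in> regular_points u"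
  shows "f (z1 + c * v1, z2 + c * v2) = l"
proof -
  define N where "N = {c. (z1 + c * v1, z2 + c * v2) \<notin> regular_points u}"
  have N: "N sparse_in UNIV"
    unfolding N_def by (rule sparse_singularities_on_line[OF mero max c v])
  show ?thesis
  proof (rule analytic_continuation_open[of S "UNIV - N" "\<lambda>c. f (z1 + c * v1, z2 + c * v2)" "\<lambda>_. l"])
    show "open (UNIV - N)" by (rule open_diff_sparse_pts[OF open_UNIV N])
    show "connected (UNIV - N)"
      by (rule sparse_imp_connected[OF _ connected_UNIV open_UNIV N]) simp
    show "(\<lambda>c. f (z1 + c * v1, z2 + c * v2)) holomorphic_on UNIV - N"
      by (rule holomorphic2_on_imp_holomorphic_on_line[OF f]) (auto simp: N_def)
  qed (use S c in \<open>auto simp: N_def\<close>)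
qed

section \<open>The Fermat equation on a line\<close>

lemma open_minus_sparse_nonempty:
  fixes N V :: "complex set"
  assumes "N sparse_in UNIV" "open V" "V \<noteq> {}"
  shows "V \<inter> (UNIV - N) \<noteq> {}"
proof -
  obtain z where z: "z \<in> V" using assms by blast
  have "\<forall>\<^sub>F y in at z. y \<notin> N" using assms(1) by (simp add: sparse_in_eventually_iff)
  moreover have "\<forall>\<^sub>F y in at z. y \<in> V"
    using z assms(2) by (auto simp: eventually_at_topological)
  ultimately have "\<forall>\<^sub>F y in at z. y \<in> V \<inter> (UNIV - N)" by eventually_elim auto
  then show ?thesis using eventually_happens'[of "at z"] by force
qed

text \<open>The growth bound makes \<open>X\<close> bounded near each point of \<open>N\<close>, so
  Riemann's theorem applies; \<open>remove_sings\<close> glues the local extensions.\<close>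

lemma extend_over_sparse:
  fixes X :: "complex \<Rightarrow> complex"
  assumes N: "N sparse_in UNIV" and hol: "X holomorphic_on (UNIV - N)"
    and bound: "\<And>t. t \<notin> N \<Longrightarrow> norm (X t) \<le> A + C * norm t" and C: "C \<ge> 0"
  obtains Y where "Y holomorphic_on UNIV" "\<And>t. t \<notin> N \<Longrightarrow> Y t = X t"
proof -
  have loc: "\<exists>e>0. \<exists>g. g holomorphic_on ball z e \<and> (\<forall>w\<in>ball z e. remove_sings X w = g w)
      \<and> (z \<notin> N \<longrightarrow> remove_sings X z = X z)" for z
  proof -
    have "\<forall>\<^sub>F w in at z. w \<notin> N" using N by (simp add: sparse_in_eventually_iff)
    then obtain e where e: "e > 0" "\<And>w. w \<noteq> z \<Longrightarrow> dist w z < e \<Longrightarrow> w \<notin> N"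
      by (auto simp: eventually_at)
    have hole: "X holomorphic_on (ball z e - {z})"
      by (rule holomorphic_on_subset[OF hol]) (use e in \<open>auto simp: dist_commute\<close>)
    have "\<forall>\<^sub>F w in at z. norm (X w) \<le> A + C * (norm z + e)"
      unfolding eventually_at
    proof (intro exI[of _ e] conjI ballI impI)
      fix w assume w: "w \<noteq> z \<and> dist w z < e"
      have "norm w \<le> norm z + e" using w norm_triangle_sub[of w z] by (simp add: dist_norm)
      then have "C * norm w \<le> C * (norm z + e)" using C by (rule mult_left_mono)
      then show "norm (X w) \<le> A + C * (norm z + e)" using bound[of w] e(2)[of w] w by simp
    qed (rule e)
    then obtain g where g: "g holomorphic_on ball z e" "\<forall>w\<in>ball z e - {z}. g w = X w"
      using holomorphic_on_extend_bounded[OF hole] e(1) by auto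
    have lim: "X \<midarrow>w\<rightarrow> g w" if w: "w \<in> ball z e" for w
    proof -
      have "isCont g w"
        using g(1) w continuous_on_eq_continuous_at[OF open_ball] holomorphic_on_imp_continuous_on by blast
      moreover have "\<forall>\<^sub>F v in at w. g v = X v"
      proof -
        have "\<forall>\<^sub>F v in at w. v \<in> ball z e - {w}" using w by (intro eventually_at_in_open) auto
        moreover have "\<forall>\<^sub>F v in at w. v \<noteq> z"
          using eventually_neq_at_within[of z w] by simp
        ultimately show ?thesis by eventually_elim (use g in auto)
      qed
      ultimately show ?thesis using isContD Lim_transform_eventually by blast
    qed
    have "remove_sings X z = X z" if "z \<notin> N"
    proof -
      have "X analytic_on {z}"
        using hol open_diff_sparse_pts[OF open_UNIV N] that by (auto simp: analytic_at)
      then show ?thesis by simp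
    qed
    then show ?thesis using e(1) g(1) remove_sings_eqI[OF lim] by blast
  qed
  have "remove_sings X holomorphic_on UNIV"
  proof (rule holomorphic_onI)
    fix z
    obtain e g where "e > 0" "g holomorphic_on ball z e" "\<forall>w\<in>ball z e. remove_sings X w = g w"
      using loc by metis
    then have "remove_sings X holomorphic_on ball z e"
      using holomorphic_cong by blast
    then show "remove_sings X field_differentiable at z within UNIV"
      using \<open>e > 0\<close> holomorphic_on_imp_differentiable_at[OF _ open_ball] by (metis centre_in_ball)
  qed
  then show ?thesis using that loc by metis
qed

lemma entire_linear_growth:
  fixes Y :: "complex \<Rightarrow> complex"
  assumes N: "N sparse_in UNIV" and hol: "Y holomorphic_on UNIV"
    and bound: "\<And>t. t \<notin> N \<Longrightarrow> norm (Y t) \<le> A + C * norm t" and AC: "A \<ge> 0" "C \<ge> 0"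
  obtains \<alpha> \<beta> where "\<And>t. Y t = \<alpha> + \<beta> * t"
proof -
  have contY: "continuous_on UNIV Y" using hol by (rule holomorphic_on_imp_continuous_on)
  have b: "norm (Y t) \<le> A + C * norm t" for t
  proof (rule ccontr)
    assume "\<not> ?thesis"
    then have "t \<in> {t. A + C * norm t < norm (Y t)}" by simp
    moreover have "open {t. A + C * norm t < norm (Y t)}"
      by (intro open_Collect_less continuous_intros contY)
    ultimately have "{t. A + C * norm t < norm (Y t)} \<inter> (UNIV - N) \<noteq> {}"
      by (intro open_minus_sparse_nonempty[OF N]) blast+
    then show False using bound by force
  qed
  have "Y t = (\<Sum>k\<le>1. (deriv ^^ k) Y 0 / fact k * t ^ k)" for t
  \<comment> \<open>For \<open>norm z\<close> at least 1 the constant \<open>A\<close> is absorbed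
    into \<open>A * norm z\<close>.\<close>
  proof (rule Liouville_polynomial[OF hol, of 1 "A + C"])
    fix z :: complex assume z: "1 \<le> norm z"
    have "A \<le> A * norm z" using z AC mult_left_mono[of 1 "norm z" A] by simp
    then show "norm (Y z) \<le> (A + C) * norm z ^ 1" using b[of z] by (simp add: algebra_simps)
  qed
  moreover have "(\<Sum>k\<le>1. (deriv ^^ k) Y 0 / fact k * t ^ k) = Y 0 + deriv Y 0 * t" for t by simp
  ultimately have "Y t = Y 0 + deriv Y 0 * t" for t by metis
  then show ?thesis by (rule that)
qed

text \<open>\<open>f\<close> and \<open>g\<close> stand for the gradient on a line parallel to the
  second axis, \<open>c\<close> for the offset of that line from the common point of the
  characteristics in the first coordinate, and \<open>w\<close> for the second coordinate of that
  point.\<close>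

lemma fermat_pencil_impossible:
  fixes f g :: "complex \<Rightarrow> complex"
  assumes N: "N sparse_in UNIV" and mn: "m \<ge> 2" "n \<ge> 2" and c: "c \<noteq> 0"
    and hol: "f holomorphic_on UNIV - N"
    and fermat: "\<And>t. t \<notin> N \<Longrightarrow> f t ^ m + g t ^ n = 1"
    and pencil: "\<And>t. t \<notin> N \<Longrightarrow> c * (of_nat n * g t ^ (n - 1)) = (t - w) * (of_nat m * f t ^ (m - 1))"
  shows False
proof -
  have f0: "f t \<noteq> 0" if "t \<notin> N" for t
  proof
    assume "f t = 0"
    then have "c * (of_nat n * g t ^ (n - 1)) = 0" using pencil[OF that] mn by simp
    then have "g t = 0" using c mn by simp
    then show False using fermat[OF that] \<open>f t = 0\<close> mn by (simp add: power_0_left)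
  qed
  \<comment> \<open>The \<open>n\<close>-th power of the pencil relation contains \<open>g\<close>
    only through \<open>g t ^ n\<close>, which the Fermat equation eliminates.\<close>
  have rel: "(of_nat m * (t - w)) ^ n * f t ^ (n * (m - 1)) = (of_nat n * c) ^ n * (1 - f t ^ m) ^ (n - 1)"
    if "t \<notin> N" for t
  proof -
    have "(of_nat m * (t - w)) ^ n * f t ^ (n * (m - 1)) = ((t - w) * (of_nat m * f t ^ (m - 1))) ^ n"
      by (simp add: power_mult_distrib power_mult mult.commute[of n])
    also have "\<dots> = (c * (of_nat n * g t ^ (n - 1))) ^ n" using pencil[OF that] by simp
    also have "\<dots> = (of_nat n * c) ^ n * (g t ^ n) ^ (n - 1)"
      by (simp add: power_mult_distrib mult.commute flip: power_mult)
    also have "g t ^ n = 1 - f t ^ m" using fermat[OF that] by (simp add: algebra_simps)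
    finally show ?thesis .
  qed
  define X where "X t = 1 / f t" for t
  \<comment> \<open>If \<open>norm (f t)\<close> is below 1/2, then \<open>1 - f t ^ m\<close> has
    norm at least 1/2, and taking \<open>n\<close>-th roots in \<open>rel\<close> gives
    \<open>1 / norm (f t) \<le> C * norm (t - w)\<close>.\<close>
  define C where "C = 2 * real m / (real n * norm c)"
  have C: "C \<ge> 0" by (simp add: C_def)
  have bound: "norm (X t) \<le> (2 + C * norm w) + C * norm t" if t: "t \<notin> N" for t
  proof (cases "norm (X t) \<le> 2")
    case True
    then show ?thesis using C by (smt (verit) mult_nonneg_nonneg norm_ge_zero)
  next
    case False
    have fs: "norm (f t) < 1 / 2"
      using False f0[OF t] by (simp add: X_def norm_divide field_simps)
    have "norm (f t ^ m) \<le> norm (f t) ^ 1"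
      unfolding norm_power by (rule power_decreasing) (use fs mn in auto)
    then have "norm (f t ^ m) \<le> 1 / 2" using fs by simp
    then have "1 / 2 \<le> norm (1 - f t ^ m)"
      using norm_triangle_sub[of 1 "f t ^ m"] by simp
    then have "(1 / 2) ^ (n - 1) \<le> norm (1 - f t ^ m) ^ (n - 1)"
      by (rule power_mono) simp
    moreover have "(1 / 2 :: real) ^ n \<le> (1 / 2) ^ (n - 1)"
      by (rule power_decreasing) auto
    ultimately have "(1 / 2) ^ n \<le> norm (1 - f t ^ m) ^ (n - 1)" by linarith
    then have "(real n * norm c) ^ n * (1 / 2) ^ n \<le> (real n * norm c) ^ n * norm (1 - f t ^ m) ^ (n - 1)"
      by (intro mult_left_mono) auto
    also have "\<dots> = norm ((of_nat n * c) ^ n * (1 - f t ^ m) ^ (n - 1))"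
      by (simp add: norm_mult norm_power)
    also have "\<dots> = (real m * norm (t - w)) ^ n * norm (f t) ^ (n * (m - 1))"
      unfolding rel[OF t, symmetric] by (simp add: norm_mult norm_power)
    \<comment> \<open>The exponent \<open>n * (m - 1)\<close> is at least \<open>n\<close> because
      \<open>m \<ge> 2\<close>, and the base is below 1.\<close>
    also have "\<dots> \<le> (real m * norm (t - w)) ^ n * norm (f t) ^ n"
      using fs mn by (intro mult_left_mono power_decreasing) auto
    finally have "(real n * norm c * (1 / 2)) ^ n \<le> (real m * norm (t - w) * norm (f t)) ^ n"
      by (simp only: power_mult_distrib)
    then have "real n * norm c * (1 / 2) \<le> real m * norm (t - w) * norm (f t)"
      using power_le_imp_le_base[of _ "n - 1"] mn by (simp add: power_mono_iff)
    then have "1 / norm (f t) \<le> C * norm (t - w)"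
      using f0[OF t] c mn by (simp add: C_def field_simps)
    also have "\<dots> \<le> C * (norm t + norm w)"
      by (intro mult_left_mono C norm_triangle_ineq4)
    finally show ?thesis by (simp add: X_def norm_divide algebra_simps)
  qed
  have holX: "X holomorphic_on UNIV - N"
    unfolding X_def by (intro holomorphic_intros hol) (use f0 in auto)
  obtain Y where Y: "Y holomorphic_on UNIV" "\<And>t. t \<notin> N \<Longrightarrow> Y t = X t"
    using extend_over_sparse[OF N holX bound C] by blast
  obtain \<alpha> \<beta> where lin: "\<And>t. Y t = \<alpha> + \<beta> * t"
    using entire_linear_growth[OF N Y(1), of "2 + C * norm w" C] bound Y(2) C by force
  have contY: "continuous_on UNIV Y" unfolding lin by (intro continuous_intros)
  have relY: "(of_nat m * (t - w)) ^ n * (1 / Y t) ^ (n * (m - 1)) = (of_nat n * c) ^ n * (1 - (1 / Y t) ^ m) ^ (n - 1)"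
    if "Y t \<noteq> 0" for t
  proof (rule eq_on_dense[where U = "{t \<in> UNIV. Y t \<noteq> 0}" and R = "UNIV - N"
        and f = "\<lambda>t. (of_nat m * (t - w)) ^ n * (1 / Y t) ^ (n * (m - 1))"
        and g = "\<lambda>t. (of_nat n * c) ^ n * (1 - (1 / Y t) ^ m) ^ (n - 1)"])
    show "(of_nat m * (t - w)) ^ n * (1 / Y t) ^ (n * (m - 1)) = (of_nat n * c) ^ n * (1 - (1 / Y t) ^ m) ^ (n - 1)"
      if "t \<in> {t \<in> UNIV. Y t \<noteq> 0} \<inter> (UNIV - N)" for t
      using rel[of t] Y(2)[of t] f0[of t] that by (simp add: X_def)
    show "open {t \<in> UNIV. Y t \<noteq> 0}" by (intro open_nonzero contY open_UNIV)
  qed (use that open_minus_sparse_nonempty[OF N] in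
       \<open>auto simp: lin intro!: continuous_intros\<close>)
  \<comment> \<open>At a root of unity the right side of \<open>relY\<close> vanishes, its exponent
    \<open>n - 1\<close> being positive, so the factor \<open>t - w\<close> on the left must
    vanish.\<close>
  have root: "t = w" if "Y t ^ m = 1" for t
  proof -
    have "Y t \<noteq> 0" using that mn by (metis power_0_left zero_neq_one not_numeral_le_zero)
    then have "(of_nat m * (t - w)) ^ n * (1 / Y t) ^ (n * (m - 1)) = 0"
      using relY[of t] mn that by (simp add: power_divide)
    then show ?thesis using mn \<open>Y t \<noteq> 0\<close> by simp
  qed
  show False
  proof (cases "\<beta> = 0")
    case True
    have "\<alpha> \<noteq> 0"
    proof
      assume "\<alpha> = 0"
      obtain t where "t \<notin> N" using open_minus_sparse_nonempty[OF N open_UNIV] by auto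
      then show False using f0[of t] Y(2)[of t] lin[of t] True \<open>\<alpha> = 0\<close> by (simp add: X_def)
    qed
    have Y: "Y t = \<alpha>" for t using lin True by simp
    \<comment> \<open>For constant \<open>Y\<close> the right side of \<open>relY\<close> is
      constant and vanishes at \<open>t = w\<close>. At \<open>t = w + 1\<close> the left side is
      then 0 although none of its factors is.\<close>
    have "(of_nat n * c) ^ n * (1 - (1 / \<alpha>) ^ m) ^ (n - 1) = 0"
      using relY[of w] Y \<open>\<alpha> \<noteq> 0\<close> mn by (simp add: power_0_left)
    then have "(of_nat m * ((w + 1) - w)) ^ n * (1 / \<alpha>) ^ (n * (m - 1)) = 0"
      using relY[of "w + 1"] Y \<open>\<alpha> \<noteq> 0\<close> by simp
    then show False using mn \<open>\<alpha> \<noteq> 0\<close> by simp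
  next
    case False
    \<comment> \<open>A nonconstant affine \<open>Y\<close> takes two distinct \<open>m\<close>-th
      roots of unity, but by \<open>root\<close> both only at \<open>w\<close>.\<close>
    have "card {z::complex. z ^ m = 1} = m" using card_roots_unity_eq[of m] mn by simp
    then have "{z::complex. z ^ m = 1} \<noteq> {1}" using mn by auto
    then obtain z :: complex where z: "z ^ m = 1" "z \<noteq> 1" by auto
    have solve: "Y ((x - \<alpha>) / \<beta>) = x" for x using lin False by simp
    have "(1 - \<alpha>) / \<beta> = w" "(z - \<alpha>) / \<beta> = w" using root solve z(1) by simp_all
    then show False using False z(2) by (simp add: field_simps)
  qed
qed

section \<open>Characteristic lines\<close>

text \<open>A Gronwall argument by maxima: on a small closed disc let \<open>E\<close> be largest at
  \<open>s0\<close>. The mean value inequality bounds \<open>X\<close> and \<open>Y\<close> at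
  \<open>s0\<close> by a quarter of \<open>E s0\<close> each, so
  \<open>E s0 \<le> E s0 / 2\<close>.\<close>

lemma linear_ode_zero:
  fixes X Y :: "complex \<Rightarrow> complex"
  assumes r: "r > 0" and X0: "X 0 = 0" "Y 0 = 0"
    and dX: "\<And>s. s \<in> ball 0 r \<Longrightarrow> (X has_field_derivative X' s) (at s)"
    and dY: "\<And>s. s \<in> ball 0 r \<Longrightarrow> (Y has_field_derivative Y' s) (at s)"
    and bX: "\<And>s. s \<in> ball 0 r \<Longrightarrow> norm (X' s) \<le> K * (norm (X s) + norm (Y s))"
    and bY: "\<And>s. s \<in> ball 0 r \<Longrightarrow> norm (Y' s) \<le> K * (norm (X s) + norm (Y s))"
  obtains e where "e > 0" "e < r" "\<And>s. s \<in> ball 0 e \<Longrightarrow> X s = 0 \<and> Y s = 0"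
proof -
  define e where "e = min (r / 2) (1 / (4 * (\<bar>K\<bar> + 1)))"
  have e: "e > 0" "e < r" using r by (auto simp: e_def)
  have eK: "e * \<bar>K\<bar> \<le> 1 / 4"
  proof -
    have "e * (\<bar>K\<bar> + 1) \<le> 1 / (4 * (\<bar>K\<bar> + 1)) * (\<bar>K\<bar> + 1)"
      unfolding e_def by (intro mult_right_mono) auto
    also have "\<dots> = 1 / 4"
    proof -
      have "\<bar>K\<bar> + 1 \<noteq> 0" by linarith
      then show ?thesis by (simp add: field_simps)
    qed
    finally show ?thesis using e(1) by (simp add: algebra_simps)
  qed
  have sub: "s \<in> ball 0 r" if "s \<in> cball 0 e" for s :: complex using that e by auto
  define E where "E s = norm (X s) + norm (Y s)" for s
  have "continuous_on (cball 0 e) E"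
    unfolding E_def using dX dY sub
    by (intro continuous_intros continuous_at_imp_continuous_on ballI) (meson DERIV_isCont)+
  then obtain s0 where s0: "s0 \<in> cball 0 e" "\<And>s. s \<in> cball 0 e \<Longrightarrow> E s \<le> E s0"
    using continuous_attains_sup[of "cball 0 e" E] e(1) by auto
  have bound: "norm (Z s0) \<le> E s0 / 4"
    if "Z 0 = 0" "\<And>s. s \<in> ball 0 r \<Longrightarrow> (Z has_field_derivative Z' s) (at s)"
       "\<And>s. s \<in> ball 0 r \<Longrightarrow> norm (Z' s) \<le> K * E s" for Z Z' :: "complex \<Rightarrow> complex"
  proof -
    have "norm (Z s0 - Z 0) \<le> (\<bar>K\<bar> * E s0) * norm (s0 - 0)"
    proof (rule field_differentiable_bound[where S = "cball 0 e"])
      fix s :: complex assume s: "s \<in> cball 0 e"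
      show "(Z has_field_derivative Z' s) (at s within cball 0 e)"
        using that(2)[OF sub[OF s]] by (rule has_field_derivative_at_within)
      have "K * E s \<le> \<bar>K\<bar> * E s0"
        by (intro mult_mono s0(2) s) (auto simp: E_def)
      then show "norm (Z' s) \<le> \<bar>K\<bar> * E s0" using that(3)[OF sub[OF s]] by linarith
    qed (use s0 e in auto)
    also have "\<dots> \<le> (\<bar>K\<bar> * E s0) * e"
      using s0(1) by (intro mult_left_mono) (auto simp: E_def)
    also have "\<dots> = (e * \<bar>K\<bar>) * E s0" by simp
    also have "\<dots> \<le> 1 / 4 * E s0" by (intro mult_right_mono eK) (auto simp: E_def)
    finally show ?thesis using that(1) by simp
  qed
  have "norm (X s0) \<le> E s0 / 4" using bound[OF X0(1) dX bX[folded E_def]] .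
  moreover have "norm (Y s0) \<le> E s0 / 4" using bound[OF X0(2) dY bY[folded E_def]] .
  ultimately have "E s0 \<le> 0" by (simp add: E_def)
  then have "E s \<le> 0" if "s \<in> ball 0 e" for s
    using s0(2)[of s] that by simp
  then have "X s = 0 \<and> Y s = 0" if "s \<in> ball 0 e" for s
    using that unfolding E_def
    by (metis add_nonneg_eq_0_iff dual_order.eq_iff norm_ge_zero add_nonneg_nonneg norm_eq_zero)
  then show ?thesis using that e by blast
qed

lemma norm_power_diff_le:
  fixes x y :: complex
  assumes "norm x \<le> T" "norm y \<le> T"
  shows "norm (x ^ k - y ^ k) \<le> real k * T ^ (k - 1) * norm (x - y)"
proof (rule field_differentiable_bound[where S = "cball 0 T"])
  fix z :: complex assume "z \<in> cball 0 T"
  show "((\<lambda>z. z ^ k) has_field_derivative of_nat k * z ^ (k - 1)) (at z within cball 0 T)"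
    by (auto intro!: derivative_eq_intros)
  show "norm (of_nat k * z ^ (k - 1)) \<le> real k * T ^ (k - 1)"
    using \<open>z \<in> cball 0 T\<close> by (auto simp: norm_mult norm_power intro!: mult_left_mono power_mono)
qed (use assms in auto)

section \<open>Constancy of the gradient along characteristics\<close>

locale fermat_solution =
  fixes m n :: nat and u :: "complex \<times> complex \<Rightarrow> complex"
  assumes m2: "m \<ge> 2" and n2: "n \<ge> 2"
    and mero: "meromorphic2_on u UNIV" and max: "maximal_representative u"
    and pde: "\<And>z. z \<in> regular_points u \<Longrightarrow> partial1 u z ^ m + partial2 u z ^ n = 1"
begin

abbreviation "R \<equiv> regular_points u"
abbreviation "p \<equiv> partial1 u"
abbreviation "q \<equiv> partial2 u"
text \<open>\<open>(V1, V2)\<close> is the gradient of \<open>a ^ m + b ^ n\<close> in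
  \<open>(a, b)\<close>, taken at \<open>(p z, q z)\<close>: the characteristic direction. It
  depends on \<open>z\<close> only through the gradient of \<open>u\<close>.\<close>

definition "V1 z = of_nat m * p z ^ (m - 1)"
definition "V2 z = of_nat n * q z ^ (n - 1)"

lemma holp: "holomorphic2_on p R" and holq: "holomorphic2_on q R"
  by (intro holomorphic2_on_partial1 holomorphic2_on_partial2 holomorphic2_on_regular_points open_regular_points)+

lemma direction_nonzero:
  assumes "z \<in> R"
  shows "V1 z \<noteq> 0 \<or> V2 z \<noteq> 0"
proof (rule ccontr)
  assume "\<not> ?thesis"
  then have "p z = 0" "q z = 0" using m2 n2 by (auto simp: V1_def V2_def)
  then show False using pde[OF assms] m2 n2 by (simp add: power_0_left)
qed

lemma pde_derivative:
  assumes "z \<in> R"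
  shows "V1 z * partial1 p z + V2 z * partial1 q z = 0"
    and "V1 z * partial2 p z + V2 z * partial2 q z = 0"
proof -
  obtain x y where z: "z = (x, y)" by (cases z)
  have xy: "(x, y) \<in> R" using assms z by simp
  have o: "open ((\<lambda>w. (w, y)) -` R)" "open ((\<lambda>w. (x, w)) -` R)"
    by (intro continuous_open_vimage[OF open_regular_points]; auto intro!: continuous_intros)+
  have "((\<lambda>w. p (w, y) ^ m + q (w, y) ^ n) has_field_derivative V1 z * partial1 p z + V2 z * partial1 q z) (at x)"
    using holomorphic2_on_slice1[OF holp xy] holomorphic2_on_slice1[OF holq xy]
    by (auto intro!: derivative_eq_intros simp: V1_def V2_def z)
  moreover have "((\<lambda>w. p (w, y) ^ m + q (w, y) ^ n) has_field_derivative 0) (at x)"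
    by (rule has_field_derivative_transform_within_open[OF DERIV_const[of 1] o(1)]) (use xy pde in auto)
  ultimately show "V1 z * partial1 p z + V2 z * partial1 q z = 0" by (rule DERIV_unique)
  have "((\<lambda>w. p (x, w) ^ m + q (x, w) ^ n) has_field_derivative V1 z * partial2 p z + V2 z * partial2 q z) (at y)"
    using holomorphic2_on_slice2[OF holp xy] holomorphic2_on_slice2[OF holq xy]
    by (auto intro!: derivative_eq_intros simp: V1_def V2_def z)
  moreover have "((\<lambda>w. p (x, w) ^ m + q (x, w) ^ n) has_field_derivative 0) (at y)"
    by (rule has_field_derivative_transform_within_open[OF DERIV_const[of 1] o(2)]) (use xy pde in auto)
  ultimately show "V1 z * partial2 p z + V2 z * partial2 q z = 0" by (rule DERIV_unique)
qed

text \<open>Symmetry of the mixed partials, \<open>partial1 q = partial2 p\<close>, turns the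
  differentiated equation into the vanishing of the derivatives of \<open>p\<close> and
  \<open>q\<close> in the characteristic direction.\<close>

lemma transport:
  assumes "z \<in> R"
  shows "partial1 p z * V1 z + partial2 p z * V2 z = 0" "partial1 q z * V1 z + partial2 q z * V2 z = 0"
  using pde_derivative[OF assms] mixed_partials[OF holomorphic2_on_regular_points open_regular_points assms]
  by (simp_all add: mult.commute)

text \<open>Along the line with the direction frozen at the start, \<open>transport\<close> holds
  for the varying direction. The two directions differ by at most a multiple of the change of
  \<open>(p, q)\<close>, so that change satisfies the hypotheses of
  \<open>linear_ode_zero\<close>.\<close>

lemma locally_constant_along_characteristic:
  assumes "(z1, z2) \<in> R"
  obtains e where "e > 0" "\<And>s. s \<in> ball 0 e \<Longrightarrow> (z1 + s * V1 (z1, z2), z2 + s * V2 (z1, z2)) \<in> R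
    \<and> p (z1 + s * V1 (z1, z2), z2 + s * V2 (z1, z2)) = p (z1, z2)
    \<and> q (z1 + s * V1 (z1, z2), z2 + s * V2 (z1, z2)) = q (z1, z2)"
proof -
  define v1 where "v1 = V1 (z1, z2)"
  define v2 where "v2 = V2 (z1, z2)"
  define L where "L s = (z1 + s * v1, z2 + s * v2)" for s
  have L0: "L 0 = (z1, z2)" by (simp add: L_def)
  define Q where "Q z = norm (p z) + norm (q z) + norm (partial1 p z) + norm (partial2 p z)
      + norm (partial1 q z) + norm (partial2 q z)" for z
  have contQ: "continuous_on R Q"
    unfolding Q_def
    by (intro continuous_intros holomorphic2_on_imp_continuous_on holp holq
        holomorphic2_on_partial1 holomorphic2_on_partial2 open_regular_points)
  define T where "T = Q (z1, z2) + 1"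
  have T0: "T \<ge> 0" "norm (p (z1, z2)) \<le> T" "norm (q (z1, z2)) \<le> T"
    by (auto simp: T_def Q_def)
  have "open (R \<inter> Q -` {..<T})"
    by (rule continuous_open_preimage[OF contQ open_regular_points open_lessThan])
  moreover have "continuous_on UNIV L" unfolding L_def by (intro continuous_intros)
  ultimately have "open (L -` (R \<inter> Q -` {..<T}))" by (rule open_vimage)
  moreover have "0 \<in> L -` (R \<inter> Q -` {..<T})" using assms by (simp add: L0 T_def)
  ultimately obtain r where r: "r > 0" "ball 0 r \<subseteq> L -` (R \<inter> Q -` {..<T})"
    using openE by blast
  have inR: "L s \<in> R" and bds: "norm (p (L s)) \<le> T" "norm (q (L s)) \<le> T"
      "norm (partial1 p (L s)) \<le> T" "norm (partial2 p (L s)) \<le> T"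
      "norm (partial1 q (L s)) \<le> T" "norm (partial2 q (L s)) \<le> T" if "s \<in> ball 0 r" for s
  proof -
    have LR: "L s \<in> R" "Q (L s) < T" using r(2) that by auto
    then show "L s \<in> R" by blast
    show "norm (p (L s)) \<le> T" "norm (q (L s)) \<le> T"
      "norm (partial1 p (L s)) \<le> T" "norm (partial2 p (L s)) \<le> T"
      "norm (partial1 q (L s)) \<le> T" "norm (partial2 q (L s)) \<le> T"
      using LR(2) norm_ge_zero[of "p (L s)"] norm_ge_zero[of "q (L s)"] norm_ge_zero[of "partial1 p (L s)"]
        norm_ge_zero[of "partial2 p (L s)"] norm_ge_zero[of "partial1 q (L s)"] norm_ge_zero[of "partial2 q (L s)"]
      unfolding Q_def by linarith+
  qed
  \<comment> \<open>\<open>Kp\<close> and \<open>Kq\<close> are Lipschitz constants of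
    \<open>m * x ^ (m - 1)\<close> and \<open>n * x ^ (n - 1)\<close> on the disc of radius
    \<open>T\<close>.\<close>
  define Kp where "Kp = real m * (real (m - 1) * T ^ (m - 1 - 1))"
  define Kq where "Kq = real n * (real (n - 1) * T ^ (n - 1 - 1))"
  define K where "K = T * (Kp + Kq)"
  have K0: "Kp \<ge> 0" "Kq \<ge> 0" using T0(1) by (auto simp: Kp_def Kq_def)
  define X where "X s = p (L s) - p (z1, z2)" for s
  define Y where "Y s = q (L s) - q (z1, z2)" for s
  have V1d: "norm (v1 - V1 (L s)) \<le> Kp * norm (X s)" if "s \<in> ball 0 r" for s
  proof -
    have "norm (v1 - V1 (L s)) = real m * norm (p (L s) ^ (m - 1) - p (z1, z2) ^ (m - 1))"
      by (simp add: v1_def V1_def norm_mult norm_minus_commute flip: right_diff_distrib)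
    also have "\<dots> \<le> real m * (real (m - 1) * T ^ (m - 1 - 1) * norm (p (L s) - p (z1, z2)))"
      by (intro mult_left_mono norm_power_diff_le bds T0 that) auto
    finally show ?thesis by (simp add: Kp_def X_def mult.assoc)
  qed
  have V2d: "norm (v2 - V2 (L s)) \<le> Kq * norm (Y s)" if "s \<in> ball 0 r" for s
  proof -
    have "norm (v2 - V2 (L s)) = real n * norm (q (L s) ^ (n - 1) - q (z1, z2) ^ (n - 1))"
      by (simp add: v2_def V2_def norm_mult norm_minus_commute flip: right_diff_distrib)
    also have "\<dots> \<le> real n * (real (n - 1) * T ^ (n - 1 - 1) * norm (q (L s) - q (z1, z2)))"
      by (intro mult_left_mono norm_power_diff_le bds T0 that) auto
    finally show ?thesis by (simp add: Kq_def Y_def mult.assoc)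
  qed
  have est: "norm (a * v1 + b * v2) \<le> K * (norm (X s) + norm (Y s))"
    if s: "s \<in> ball 0 r" and ab: "norm a \<le> T" "norm b \<le> T" "a * V1 (L s) + b * V2 (L s) = 0" for a b s
  proof -
    have "a * v1 + b * v2 = a * (v1 - V1 (L s)) + b * (v2 - V2 (L s))"
      using ab(3) by (simp add: algebra_simps)
    then have "norm (a * v1 + b * v2) \<le> norm a * norm (v1 - V1 (L s)) + norm b * norm (v2 - V2 (L s))"
      by (metis norm_mult norm_triangle_ineq)
    also have "\<dots> \<le> T * (Kp * norm (X s)) + T * (Kq * norm (Y s))"
      by (intro add_mono mult_mono ab V1d V2d s T0 norm_ge_zero)
    also have "\<dots> \<le> K * (norm (X s) + norm (Y s))"
      using T0(1) K0 by (simp add: K_def algebra_simps)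
    finally show ?thesis .
  qed
  obtain e where e: "e > 0" "e < r" "\<And>s. s \<in> ball 0 e \<Longrightarrow> X s = 0 \<and> Y s = 0"
  proof (rule linear_ode_zero[OF r(1), of X Y])
    show "(X has_field_derivative partial1 p (L s) * v1 + partial2 p (L s) * v2) (at s)" if "s \<in> ball 0 r" for s
      using DERIV_diff[OF holomorphic2_on_line[OF holp] DERIV_const] inR[OF that] unfolding X_def L_def by simp
    show "(Y has_field_derivative partial1 q (L s) * v1 + partial2 q (L s) * v2) (at s)" if "s \<in> ball 0 r" for s
      using DERIV_diff[OF holomorphic2_on_line[OF holq] DERIV_const] inR[OF that] unfolding Y_def L_def by simp
    show "norm (partial1 p (L s) * v1 + partial2 p (L s) * v2) \<le> K * (norm (X s) + norm (Y s))"
      if "s \<in> ball 0 r" for s by (rule est[OF that bds(3,4)[OF that] transport(1)[OF inR[OF that]]])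
    show "norm (partial1 q (L s) * v1 + partial2 q (L s) * v2) \<le> K * (norm (X s) + norm (Y s))"
      if "s \<in> ball 0 r" for s by (rule est[OF that bds(5,6)[OF that] transport(2)[OF inR[OF that]]])
  qed (auto simp: X_def Y_def L0)
  show ?thesis
  proof (rule that[OF e(1)], unfold v1_def[symmetric] v2_def[symmetric])
    fix s :: complex assume "s \<in> ball 0 e"
    then show "(z1 + s * v1, z2 + s * v2) \<in> R \<and> p (z1 + s * v1, z2 + s * v2) = p (z1, z2)
        \<and> q (z1 + s * v1, z2 + s * v2) = q (z1, z2)"
      using e(2) e(3)[of s] inR[of s] by (auto simp: X_def Y_def L_def)
  qed
qed

lemma constant_along_characteristic:
  assumes z: "z \<in> R" and c: "(fst z + c * V1 z, snd z + c * V2 z) \<in> R"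
  shows "p (fst z + c * V1 z, snd z + c * V2 z) = p z" "q (fst z + c * V1 z, snd z + c * V2 z) = q z"
proof -
  have zz: "(fst z, snd z) \<in> R" using z by simp
  obtain e where e: "e > 0" "\<And>s. s \<in> ball 0 e \<Longrightarrow> (fst z + s * V1 z, snd z + s * V2 z) \<in> R
    \<and> p (fst z + s * V1 z, snd z + s * V2 z) = p z
    \<and> q (fst z + s * V1 z, snd z + s * V2 z) = q z"
    using locally_constant_along_characteristic[OF zz] by (metis prod.collapse)
  note 1 = constant_along_line[OF mero max direction_nonzero[OF z] _ open_ball[of 0 e] _ _ _ c]
  show "p (fst z + c * V1 z, snd z + c * V2 z) = p z"
    by (rule 1[OF holp]) (use e in auto)
  show "q (fst z + c * V1 z, snd z + c * V2 z) = q z"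
    by (rule 1[OF holq]) (use e in auto)
qed

section \<open>Crossing and concurrent characteristics\<close>

text \<open>At a regular intersection the gradient would equal those at \<open>z\<close> and at
  \<open>z'\<close>, and equal gradients have equal directions.\<close>

lemma crossing_singular:
  assumes "z \<in> R" "z' \<in> R" and "V1 z * V2 z' \<noteq> V2 z * V1 z'"
    and "(fst z + s * V1 z, snd z + s * V2 z) = (fst z' + t * V1 z', snd z' + t * V2 z')"
  shows "(fst z + s * V1 z, snd z + s * V2 z) \<notin> R"
proof
  assume "(fst z + s * V1 z, snd z + s * V2 z) \<in> R"
  then have "p z = p z'" "q z = q z'"
    using constant_along_characteristic[OF assms(1), of s] constant_along_characteristic[OF assms(2), of t] assms(4)
    by simp_all
  then have "V1 z = V1 z'" "V2 z = V2 z'" by (simp_all add: V1_def V2_def)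
  then show False using assms(3) by simp
qed

lemma continuous_V: "continuous_on R V1" "continuous_on R V2"
  unfolding V1_def V2_def
  by (intro continuous_intros holomorphic2_on_imp_continuous_on holp holq)+

lemma concurrent_characteristics:
  assumes z0: "z0 \<in> R" and z1: "z1 \<in> R" and cross: "V1 z0 * V2 z1 \<noteq> V2 z0 * V1 z1"
  obtains w B where "open B" "B \<noteq> {}" "B \<subseteq> R"
    "\<And>z. z \<in> B \<Longrightarrow> (fst z - fst w) * V2 z = (snd z - snd w) * V1 z"
proof -
  define N where "N = {c. (fst z0 + c * V1 z0, snd z0 + c * V2 z0) \<notin> R}"
  have "N sparse_in UNIV"
    unfolding N_def
    by (rule sparse_singularities_on_line[OF mero max, of _ 0]) (use z0 direction_nonzero[OF z0] in auto)
  then have N: "countable N" using sparse_imp_countable[OF open_UNIV] by simp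
  define d where "d z = V1 z0 * V2 z - V2 z0 * V1 z" for z
  \<comment> \<open>By Cramer's rule, the parameter on the characteristic of \<open>z0\<close> at
    which it meets the characteristic of \<open>z\<close>; \<open>d z\<close> is the determinant of
    the two directions.\<close>
  define \<sigma> where "\<sigma> z = ((fst z - fst z0) * V2 z - (snd z - snd z0) * V1 z) / d z" for z
  have contd: "continuous_on R d" unfolding d_def by (intro continuous_intros continuous_V)
  have "open {z \<in> R. d z \<noteq> 0}" by (intro open_nonzero contd open_regular_points)
  moreover have "z1 \<in> {z \<in> R. d z \<noteq> 0}" using z1 cross by (simp add: d_def)
  ultimately obtain e where e: "e > 0" "ball z1 e \<subseteq> {z \<in> R. d z \<noteq> 0}" using openE by blast
  let ?B = "ball z1 e"
  have BR: "?B \<subseteq> R" using e by blast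
  have cont\<sigma>: "continuous_on ?B \<sigma>"
    unfolding \<sigma>_def using e(2)
    by (intro continuous_intros continuous_on_subset[OF continuous_V(1) BR] continuous_on_subset[OF continuous_V(2) BR]
        continuous_on_subset[OF contd BR]) auto
  have "\<sigma> z \<in> N" if z: "z \<in> ?B" for z
  proof -
    have zR: "z \<in> R" and dz: "d z \<noteq> 0" using e z by auto
    \<comment> \<open>The parameter of the same intersection point on the characteristic of
      \<open>z\<close>.\<close>
    define \<tau> where "\<tau> = ((fst z - fst z0) * V2 z0 - (snd z - snd z0) * V1 z0) / d z"
    have "(fst z0 + \<sigma> z * V1 z0 - fst z) * d z = \<tau> * V1 z * d z"
      using dz unfolding \<sigma>_def \<tau>_def by (simp add: field_simps) (simp add: d_def algebra_simps)
    moreover have "(snd z0 + \<sigma> z * V2 z0 - snd z) * d z = \<tau> * V2 z * d z"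
      using dz unfolding \<sigma>_def \<tau>_def by (simp add: field_simps) (simp add: d_def algebra_simps)
    ultimately have "fst z0 + \<sigma> z * V1 z0 - fst z = \<tau> * V1 z" "snd z0 + \<sigma> z * V2 z0 - snd z = \<tau> * V2 z"
      using dz by simp_all
    then have "(fst z0 + \<sigma> z * V1 z0, snd z0 + \<sigma> z * V2 z0) = (fst z + \<tau> * V1 z, snd z + \<tau> * V2 z)"
      by (simp add: algebra_simps)
    then have "(fst z0 + \<sigma> z * V1 z0, snd z0 + \<sigma> z * V2 z0) \<notin> R"
      by (rule crossing_singular[OF z0 zR, rotated]) (use dz in \<open>auto simp: d_def\<close>)
    then show ?thesis by (simp add: N_def)
  qed
  then have "countable (\<sigma> ` ?B)" using N by (meson countable_subset image_subsetI)
  moreover have "connected (\<sigma> ` ?B)" by (rule connected_continuous_image[OF cont\<sigma> connected_ball])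
  \<comment> \<open>A connected set of complex numbers with two points is uncountable.\<close>
  ultimately have const: "\<sigma> z = \<sigma> z1" if "z \<in> ?B" for z
    using connected_uncountable[of "\<sigma> ` ?B"] that e(1) by (metis centre_in_ball imageI)
  define w where "w = (fst z0 + \<sigma> z1 * V1 z0, snd z0 + \<sigma> z1 * V2 z0)"
  show ?thesis
  proof (rule that[of ?B w])
    show "(fst z - fst w) * V2 z = (snd z - snd w) * V1 z" if z: "z \<in> ?B" for z
    proof -
      have "d z \<noteq> 0" using e z by auto
      then have "\<sigma> z * d z = (fst z - fst z0) * V2 z - (snd z - snd z0) * V1 z"
        unfolding \<sigma>_def by simp
      then have "\<sigma> z1 * d z = (fst z - fst z0) * V2 z - (snd z - snd z0) * V1 z"
        by (simp only: const[OF z])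
      then show ?thesis by (simp add: w_def d_def algebra_simps)
    qed
  qed (use e BR in auto)
qed

lemma not_concurrent:
  assumes B: "open B" "B \<noteq> {}" "B \<subseteq> R"
    and conc: "\<And>z. z \<in> B \<Longrightarrow> (fst z - fst w) * V2 z = (snd z - snd w) * V1 z"
  shows False
proof -
  obtain x y where xy: "(x, y) \<in> B" "x \<noteq> fst w"
  proof -
    obtain x0 y where "(x0, y) \<in> B" using B by auto
    then obtain A A' where A: "open A" "x0 \<in> A" "y \<in> A'" "A \<times> A' \<subseteq> B"
      using open_prod_elim[OF B(1)] by (metis mem_Sigma_iff)
    then have "A \<noteq> {fst w}" using not_open_singleton by metis
    then show ?thesis using that A by blast
  qed
  define c where "c = x - fst w"
  define N where "N = {t. (x, t) \<notin> R}"
  have N: "N sparse_in UNIV"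
    using sparse_singularities_on_line[OF mero max, of x y 0 0 1] xy B by (auto simp: N_def)
  have conn: "connected (UNIV - N)"
    by (rule sparse_imp_connected[OF _ connected_UNIV open_UNIV N]) simp
  have oN: "open (UNIV - N)" by (rule open_diff_sparse_pts[OF open_UNIV N])
  have hp: "(\<lambda>t. p (x, t)) holomorphic_on UNIV - N" and hq: "(\<lambda>t. q (x, t)) holomorphic_on UNIV - N"
    by (rule holomorphic2_on_imp_holomorphic_on_slice2[OF holp] holomorphic2_on_imp_holomorphic_on_slice2[OF holq]; simp add: N_def)+
  have oB: "open ((\<lambda>t. (x, t)) -` B)"
    by (rule continuous_open_vimage[OF B(1)]) (auto intro!: continuous_intros)
  show False
  proof (rule fermat_pencil_impossible[OF N m2 n2 _ hp])
    show "c \<noteq> 0" using xy by (simp add: c_def)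
    show "p (x, t) ^ m + q (x, t) ^ n = 1" if "t \<notin> N" for t
      using pde that by (simp add: N_def)
    \<comment> \<open>Concurrence is known only on the slice of \<open>B\<close>; the identity
      theorem spreads it over the connected set of regular parameters.\<close>
    show "c * (of_nat n * q (x, t) ^ (n - 1)) = (t - snd w) * (of_nat m * p (x, t) ^ (m - 1))" if "t \<notin> N" for t
    proof (rule analytic_continuation_open[OF oB oN _ conn,
          where f = "\<lambda>t. c * (of_nat n * q (x, t) ^ (n - 1))" and g = "\<lambda>t. (t - snd w) * (of_nat m * p (x, t) ^ (m - 1))"])
      show "(\<lambda>t. c * (of_nat n * q (x, t) ^ (n - 1))) holomorphic_on UNIV - N"
           "(\<lambda>t. (t - snd w) * (of_nat m * p (x, t) ^ (m - 1))) holomorphic_on UNIV - N"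
        by (intro holomorphic_intros hp hq)+
      show "c * (of_nat n * q (x, t) ^ (n - 1)) = (t - snd w) * (of_nat m * p (x, t) ^ (m - 1))"
        if "t \<in> (\<lambda>t. (x, t)) -` B" for t
        using conc[of "(x, t)"] that by (simp add: c_def V1_def V2_def)
    qed (use that xy B in \<open>auto simp: N_def\<close>)
  qed
qed

section \<open>Parallel characteristics and affine solutions\<close>

text \<open>The polynomial \<open>P\<close> takes the value \<open>a\<close> at 0 and
  \<open>- b\<close> at 1, so it is not the zero polynomial.\<close>

lemma finite_fermat_slope_roots:
  fixes a b :: complex
  assumes "a \<noteq> 0 \<or> b \<noteq> 0"
  shows "finite {x. a * (1 - x ^ m) ^ (n - 1) = b * x ^ ((m - 1) * n)}"
proof -
  define P where "P = smult a ((1 - monom 1 m) ^ (n - 1)) - monom b ((m - 1) * n)"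
  have pP: "poly P x = a * (1 - x ^ m) ^ (n - 1) - b * x ^ ((m - 1) * n)" for x
    by (simp add: P_def poly_monom poly_power)
  have "poly P 0 = a" using m2 n2 by (simp add: pP power_0_left)
  moreover have "poly P 1 = - b" using m2 n2 by (simp add: pP)
  ultimately have "P \<noteq> 0" using assms by auto
  then have "finite {x. poly P x = 0}" by (rule poly_roots_finite)
  then show ?thesis by (simp add: pP)
qed

text \<open>The \<open>n\<close>-th power of the slope relation, with
  \<open>q z ^ n = 1 - p z ^ m\<close>, is a nontrivial polynomial equation for \<open>p z\<close>.
  A continuous function with finitely many values on a ball is constant; \<open>q\<close> follows
  from \<open>q z ^ n = 1 - p0 ^ m\<close>.\<close>

lemma parallel_characteristics:
  assumes z0: "z0 \<in> R" and B: "ball z0 e \<subseteq> R" "e > 0"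
    and par: "\<And>z. z \<in> ball z0 e \<Longrightarrow> V1 z0 * V2 z = V2 z0 * V1 z"
  obtains a b c where "\<And>z. z \<in> ball z0 e \<Longrightarrow> u z = a * fst z + b * snd z + c"
proof -
  let ?B = "ball z0 e"
  define a where "a = (V1 z0 * of_nat n) ^ n"
  define b where "b = (V2 z0 * of_nat m) ^ n"
  have ab: "a \<noteq> 0 \<or> b \<noteq> 0" using direction_nonzero[OF z0] m2 n2 by (auto simp: a_def b_def)
  have contp: "continuous_on ?B p" and contq: "continuous_on ?B q"
    using holp holq B(1) continuous_on_subset holomorphic2_on_imp_continuous_on by blast+
  have "a * (1 - p z ^ m) ^ (n - 1) = b * p z ^ ((m - 1) * n)" if z: "z \<in> ?B" for z
  proof -
    have "1 - p z ^ m = q z ^ n" using pde[of z] z B by (auto simp: algebra_simps)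
    then have "a * (1 - p z ^ m) ^ (n - 1) = (V1 z0 * V2 z) ^ n"
      by (simp add: a_def V2_def power_mult_distrib mult.commute[of n] mult.assoc flip: power_mult)
    also have "\<dots> = (V2 z0 * V1 z) ^ n" using par[OF z] by simp
    also have "\<dots> = b * p z ^ ((m - 1) * n)"
      by (simp add: b_def V1_def power_mult_distrib power_mult mult.assoc)
    finally show ?thesis .
  qed
  then have "p ` ?B \<subseteq> {x. a * (1 - x ^ m) ^ (n - 1) = b * x ^ ((m - 1) * n)}" by blast
  then have "finite (p ` ?B)" using finite_fermat_slope_roots[OF ab] finite_subset by blast
  then have "p constant_on ?B" by (rule continuous_finite_range_constant[OF connected_ball contp])
  then obtain p0 where p0: "\<And>z. z \<in> ?B \<Longrightarrow> p z = p0" unfolding constant_on_def by blast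
  have "q ` ?B \<subseteq> {x. x ^ n = 1 - p0 ^ m}" using pde p0 B(1) by (force simp: algebra_simps)
  moreover have "finite {x::complex. x ^ n = 1 - p0 ^ m}" using n2 by (intro finite_nth_roots) simp
  ultimately have "finite (q ` ?B)" by (rule finite_subset)
  then have "q constant_on ?B" by (rule continuous_finite_range_constant[OF connected_ball contq])
  then obtain q0 where q0: "\<And>z. z \<in> ?B \<Longrightarrow> q z = q0" unfolding constant_on_def by blast
  have "\<exists>c. \<forall>z\<in>?B. u z - (p0 * fst z + q0 * snd z) = c"
  proof (rule has_derivative_zero_constant)
    fix z assume z: "z \<in> ?B"
    have "(u has_derivative (\<lambda>(s, t). p0 * s + q0 * t)) (at z within ?B)"
      using has_derivative_at_withinI[OF holomorphic2_on_partials[OF holomorphic2_on_regular_points]] z B(1) p0 q0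
      by (metis subsetD)
    then show "((\<lambda>z. u z - (p0 * fst z + q0 * snd z)) has_derivative (\<lambda>h. 0)) (at z within ?B)"
      by (auto intro!: derivative_eq_intros simp: split_def)
  qed simp
  then obtain c where "\<forall>z\<in>?B. u z - (p0 * fst z + q0 * snd z) = c" by blast
  then have "u z = p0 * fst z + q0 * snd z + c" if "z \<in> ?B" for z
    using that by (metis add.commute diff_add_cancel)
  then show ?thesis using that by blast
qed

text \<open>The difference from the affine function vanishes on an open set of parameters of the
  line joining \<open>z0\<close> to \<open>z\<close>, and \<open>constant_along_line\<close> carries
  this to \<open>z\<close>.\<close>

lemma affine_globally:
  assumes B: "z0 \<in> R" "ball z0 e \<subseteq> R" "e > 0"
    and aff: "\<And>z. z \<in> ball z0 e \<Longrightarrow> u z = a * fst z + b * snd z + c" and z: "z \<in> R"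
  shows "u z = a * fst z + b * snd z + c"
proof (cases "z = z0")
  case True
  then show ?thesis using aff B by simp
next
  case False
  define L where "L s = (fst z0 + s * (fst z - fst z0), snd z0 + s * (snd z - snd z0))" for s
  have L: "L 0 = z0" "L 1 = z" by (simp_all add: L_def)
  have contL: "continuous_on UNIV L" unfolding L_def by (intro continuous_intros)
  have "u (L 1) - (a * fst (L 1) + b * snd (L 1) + c) = 0"
    unfolding L_def
  proof (rule constant_along_line[OF mero max, of _ _ "\<lambda>z. u z - (a * fst z + b * snd z + c)" "L -` ball z0 e"])
    show "fst z - fst z0 \<noteq> 0 \<or> snd z - snd z0 \<noteq> 0" using False by (auto simp: prod_eq_iff)
    show "holomorphic2_on (\<lambda>z. u z - (a * fst z + b * snd z + c)) R"
      by (intro holomorphic2_on_diff holomorphic2_on_regular_points holomorphic2_on_affine)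
    show "open (L -` ball z0 e)" by (rule open_vimage[OF open_ball contL])
    show "L -` ball z0 e \<noteq> {}" using L(1) B(3) by (metis centre_in_ball empty_iff vimageI)
  qed (use B(2) aff z in \<open>auto simp: L_def\<close>)
  then show ?thesis by (simp add: L)
qed

lemma affine: "\<exists>a b c. \<forall>z\<in>R. u z = a * fst z + b * snd z + c"
proof -
  obtain z0 where z0: "z0 \<in> R" using dense_regular_points[OF mero open_UNIV] by auto
  then obtain e where e: "e > 0" "ball z0 e \<subseteq> R" using open_regular_points openE by blast
  \<comment> \<open>A single nonparallel characteristic nearby would produce an open set of
    concurrent ones, which is impossible.\<close>
  have "V1 z0 * V2 z = V2 z0 * V1 z" if "z \<in> ball z0 e" for z
    using concurrent_characteristics[OF z0, of z] not_concurrent that e(2) by (metis subsetD)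
  then obtain a b c where "\<And>z. z \<in> ball z0 e \<Longrightarrow> u z = a * fst z + b * snd z + c"
    using parallel_characteristics[OF z0 e(2,1)] by metis
  then show ?thesis using affine_globally[OF z0 e(2,1)] by blast
qed

end

theorem corollary1p3:
  fixes m n :: nat and u :: "complex \<times> complex \<Rightarrow> complex"
  assumes "m \<ge> 2" and "n \<ge> 2"
    and "meromorphic2_on u UNIV"
    and "\<forall>z\<in>regular_points u. partial1 u z ^ m + partial2 u z ^ n = 1"
  shows "\<exists>a b c. \<forall>z\<in>regular_points u. u z = a * fst z + b * snd z + c"
proof -
  obtain v where v: "meromorphic2_on v UNIV" "maximal_representative v"
      "regular_points u \<subseteq> regular_points v" "\<And>z. z \<in> regular_points u \<Longrightarrow> v z = u z"
    using ex_maximal_representative[OF assms(3)] by blast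
  \<comment> \<open>The equation is given on the regular points of \<open>u\<close> only; their
    density extends it to those of \<open>v\<close>.\<close>
  have "partial1 v z ^ m + partial2 v z ^ n = 1" if "z \<in> regular_points v" for z
  proof (rule eq_on_dense[OF _ _ open_regular_points[of v]])
    show "continuous_on (regular_points v) (\<lambda>z. partial1 v z ^ m + partial2 v z ^ n)"
      by (intro continuous_intros holomorphic2_on_imp_continuous_on holomorphic2_on_partial1
          holomorphic2_on_partial2 holomorphic2_on_regular_points open_regular_points)
    show "V \<inter> regular_points u \<noteq> {}" if "open V" "V \<noteq> {}" for V
      using dense_regular_points[OF assms(3) that] .
    show "partial1 v z ^ m + partial2 v z ^ n = 1" if "z \<in> regular_points v \<inter> regular_points u" for z
      using partials_cong[OF holomorphic2_on_regular_points[of u] open_regular_points, of v z] v(4) that assms(4)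
      by auto
  qed (use that in auto)
  then interpret fermat_solution m n v
    using assms v by unfold_locales auto
  obtain a b c where "\<forall>z\<in>regular_points v. v z = a * fst z + b * snd z + c"
    using affine by blast
  then have "\<forall>z\<in>regular_points u. u z = a * fst z + b * snd z + c"
    using v(3,4) by (metis subsetD)
  then show ?thesis by blast
qed

end
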